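(* For a non-degenerate uniform grid model, there are constants $0<c\le C$ depending only on the model such that \[ \frac{c}{n}\le\mathbb{E}[\operatorname{Fav}(S_n)]\le\frac{C}{n}\qquad\text{for all } n\ge1. \]
   Context: Fix an integer $L\ge2$ and let $\mathcal{D}_n$ be the set of closed squares obtained by dividing $[0,1]^2$ into an $L^n\times L^n$ grid. A grid model is a probability distribution $\mathfrak X$ on finite sets of distinct squares of $\mathcal{D}_1$ (random number $\mathbf L$ of squares, bounded) with $\mathbb{E}[\mathbf L]=L$. Random sets: $\mathcal{S}_0=\{[0,1]^2\}$; given $\mathcal{S}_n$, for each $R\in\mathcal{S}_n$ independently (and independently of $\mathcal{S}_n$) sample from $\mathfrak X$ and map the chosen squares into $R$ via the natural homothety $[0,1]^2\to R$; $\mathcal{S}_{n+1}$ is the collection of resulting squares and $S_n=\bigcup\mathcal{S}_n$. Uniform: $\mathbb{P}[Q\in\mathcal{S}_1]=1/L$ for each $Q\in\mathcal{D}_1$. Vertically degenerate: almost surely $\mathcal{S}_1$ contains exactly one square in each column of the $L\times L$ grid; horizontally degenerate: almost surely exactly one square in each row; non-degenerate: neither vertically nor horizontally degenerate. $\operatorname{Fav}(A)=\int_0^\pi|\operatorname{proj}_\theta A|\,d\theta$ where $\operatorname{proj}_\theta(x)=\langle x,(-\sin\theta,\cos\theta)\rangle$ and $|\cdot|$ is one-dimensional Lebesgue measure. *)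

theory Defs
  imports "HOL-Analysis.Analysis" "HOL-Probability.Probability"
begin

(* Squares of D_1 are indexed by (i,j) with i,j < L: i = column (x-direction),
   j = row (y-direction). The square of D_n with index (a,b) is
   [a/L^n,(a+1)/L^n] x [b/L^n,(b+1)/L^n]. *)

definition grid_square :: "nat \<Rightarrow> nat \<Rightarrow> nat \<times> nat \<Rightarrow> (real \<times> real) set" where
  "grid_square L n Q = {real (fst Q) / real L ^ n .. (real (fst Q) + 1) / real L ^ n}
                     \<times> {real (snd Q) / real L ^ n .. (real (snd Q) + 1) / real L ^ n}"

definition grid_model :: "nat \<Rightarrow> (nat \<times> nat) set pmf \<Rightarrow> bool" where
  "grid_model L X \<longleftrightarrow>
     (\<forall>S \<in> set_pmf X. S \<subseteq> {..<L} \<times> {..<L}) \<and>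
     measure_pmf.expectation X (\<lambda>S. real (card S)) = real L"

definition uniform_model :: "nat \<Rightarrow> (nat \<times> nat) set pmf \<Rightarrow> bool" where
  "uniform_model L X \<longleftrightarrow>
     (\<forall>Q \<in> {..<L} \<times> {..<L}. measure_pmf.prob X {S. Q \<in> S} = 1 / real L)"

definition vert_degenerate :: "nat \<Rightarrow> (nat \<times> nat) set pmf \<Rightarrow> bool" where
  "vert_degenerate L X \<longleftrightarrow>
     (AE S in measure_pmf X. \<forall>i<L. card {j. (i, j) \<in> S} = 1)"

definition horiz_degenerate :: "nat \<Rightarrow> (nat \<times> nat) set pmf \<Rightarrow> bool" where
  "horiz_degenerate L X \<longleftrightarrow>
     (AE S in measure_pmf X. \<forall>j<L. card {i. (i, j) \<in> S} = 1)"

definition non_degenerate :: "nat \<Rightarrow> (nat \<times> nat) set pmf \<Rightarrow> bool" where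
  "non_degenerate L X \<longleftrightarrow> \<not> vert_degenerate L X \<and> \<not> horiz_degenerate L X"

definition child_index :: "nat \<Rightarrow> nat \<times> nat \<Rightarrow> nat \<times> nat \<Rightarrow> nat \<times> nat" where
  "child_index L R Q = (L * fst R + fst Q, L * snd R + snd Q)"

definition refine_step :: "nat \<Rightarrow> (nat \<times> nat) set pmf \<Rightarrow> (nat \<times> nat) set \<Rightarrow> (nat \<times> nat) set pmf" where
  "refine_step L X S =
     map_pmf (\<lambda>f. \<Union>R\<in>S. child_index L R ` f R) (Pi_pmf S {} (\<lambda>_. X))"

primrec grid_sets :: "nat \<Rightarrow> (nat \<times> nat) set pmf \<Rightarrow> nat \<Rightarrow> (nat \<times> nat) set pmf" where
  "grid_sets L X 0 = return_pmf {(0, 0)}"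
| "grid_sets L X (Suc n) = bind_pmf (grid_sets L X n) (refine_step L X)"

definition grid_union :: "nat \<Rightarrow> nat \<Rightarrow> (nat \<times> nat) set \<Rightarrow> (real \<times> real) set" where
  "grid_union L n S = (\<Union>Q\<in>S. grid_square L n Q)"

definition proj_theta :: "real \<Rightarrow> real \<times> real \<Rightarrow> real" where
  "proj_theta \<theta> x = - fst x * sin \<theta> + snd x * cos \<theta>"

definition Fav :: "(real \<times> real) set \<Rightarrow> real" where
  "Fav A = integral {0..pi} (\<lambda>\<theta>. measure lebesgue (proj_theta \<theta> ` A))"

end

theory Submission
  imports Defs
begin

text \<open>
  Fix a direction \<open>\<theta>\<close> and parametrise the lines in this direction by \<open>t\<close>. The probability \<open>surv \<theta> n t\<close> that the line
  meets \<open>S\<^sub>n\<close> obeys a branching recursion whose linearisation \<open>avg\<close> preserves integrals and fixes the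
  chord length of the unit square; the process is therefore critical, and survival to generation \<open>n\<close> has
  probability of order \<open>1/n\<close>.

  For the lower bound, a second-moment estimate shows that \<open>surv \<theta> n\<close> dominates \<open>c/n\<close> times the chord length.
  For the upper bound, let \<open>A \<noteq> B\<close> be two squares of the first generation which are selected together with positive
  probability, and let \<open>A'\<close> be a small descendant of \<open>A\<close> such that every line through \<open>A'\<close> crosses \<open>B\<close> in a
  substantial chord. Each time the digits of a surviving square pass through \<open>A'\<close>, the quadratic
  loss from the pair \<open>(A, B)\<close> is paid from the conserved chord length. Hence \<open>m\<close> such passages bound the
  survival probability by \<open>C/m\<close>, and since digits are independent and uniform, all but an exponentially small fraction
  of the squares has a number of passages linear in \<open>n\<close>. Such a pair exists near each direction: in axis
  directions by non-degeneracy, in oblique ones because lines cutting off a corner of the unit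
  square meet fewer squares than average. Compactness of \<open>[0, \<pi>]\<close> makes the constants uniform.
\<close>

subsection \<open>Lines and the branching recursion\<close>

lemma one_minus_prod_le_sum:
  fixes x :: "'a \<Rightarrow> real"
  assumes "\<And>i. i \<in> S \<Longrightarrow> 0 \<le> x i \<and> x i \<le> 1"
  shows "1 - (\<Prod>i\<in>S. 1 - x i) \<le> (\<Sum>i\<in>S. x i)"
  using Weierstrass_prod_ineq[of S x] assms by auto

text \<open>Union bound for independent events with one joint term kept: the factors at
  \<open>a\<close> and \<open>b\<close> are expanded exactly, the Weierstrass inequality handles the
  rest. The term \<open>x a * x b\<close> is the source of the quadratic loss.\<close>

lemma one_minus_prod_le_sum_pair:
  fixes x :: "'a \<Rightarrow> real"
  assumes fin: "finite S" and x: "\<And>i. i \<in> S \<Longrightarrow> 0 \<le> x i \<and> x i \<le> 1"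
    and ab: "a \<in> S" "b \<in> S" "a \<noteq> b"
  shows "1 - (\<Prod>i\<in>S. 1 - x i) \<le> (\<Sum>i\<in>S. x i) - x a * x b"
proof -
  define R where "R = S - {a} - {b}"
  define P where "P = (\<Prod>i\<in>R. 1 - x i)"
  define s where "s = (\<Sum>i\<in>R. x i)"
  have finR: "finite R" using fin by (simp add: R_def)
  have prod: "(\<Prod>i\<in>S. 1 - x i) = (1 - x a) * ((1 - x b) * P)"
    unfolding P_def R_def using ab fin by (subst prod.remove[of _ a]; simp; subst prod.remove[of _ b]; simp)
  have sum: "(\<Sum>i\<in>S. x i) = x a + (x b + s)"
    unfolding s_def R_def using ab fin by (subst sum.remove[of _ a]; simp; subst sum.remove[of _ b]; simp)
  have P: "1 - s \<le> P"
    unfolding P_def s_def using x by (intro Weierstrass_prod_ineq) (auto simp: R_def)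
  have s: "s \<ge> 0" unfolding s_def using x by (intro sum_nonneg) (auto simp: R_def)
  define q where "q = (1 - x a) * (1 - x b)"
  have q: "0 \<le> q" "q \<le> 1" unfolding q_def using x ab by (auto intro!: mult_le_one)
  have "q * (1 - s) \<le> q * P" using P q by (intro mult_left_mono)
  moreover have "q * s \<le> 1 * s" using q s by (intro mult_right_mono) auto
  ultimately have "q - s \<le> q * P" by (simp add: algebra_simps)
  then show ?thesis unfolding prod sum by (simp add: q_def algebra_simps)
qed

text \<open>With \<open>s\<close> the sum, \<open>1 - x \<le> exp (- x)\<close> bounds the product
  by \<open>exp (- s)\<close>, and \<open>exp (- s) \<le> 1 - s + s\<^sup>2\<close> for
  \<open>s \<ge> 0\<close>.\<close>

lemma one_minus_prod_ge_sum_minus_square: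
  fixes x :: "'a \<Rightarrow> real"
  assumes x: "\<And>i. i \<in> S \<Longrightarrow> 0 \<le> x i \<and> x i \<le> 1"
  shows "(\<Sum>i\<in>S. x i) - (\<Sum>i\<in>S. x i)\<^sup>2 \<le> 1 - (\<Prod>i\<in>S. 1 - x i)"
proof -
  define s where "s = (\<Sum>i\<in>S. x i)"
  have s: "s \<ge> 0" unfolding s_def using x by (intro sum_nonneg) auto
  show ?thesis
  proof (cases "finite S")
    case True
    have "(\<Prod>i\<in>S. 1 - x i) \<le> (\<Prod>i\<in>S. exp (- x i))"
      using x exp_ge_add_one_self[of "- x _"] by (intro prod_mono) (auto simp: algebra_simps)
    also have "\<dots> = exp (- s)" using True by (simp add: s_def exp_sum sum_negf[symmetric])
    finally have *: "(\<Prod>i\<in>S. 1 - x i) \<le> exp (- s)" .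
    have "exp (- s) \<le> 1 - s + s\<^sup>2"
    proof (cases "s \<le> 1")
      case True
      have "1 + s \<le> exp s" by (rule exp_ge_add_one_self)
      then have "exp (- s) \<le> 1 / (1 + s)" using s
        by (simp add: exp_minus field_simps)
      also have "\<dots> \<le> 1 - s + s\<^sup>2"
        using s by (simp add: field_simps power2_eq_square)
      finally show ?thesis .
    next
      case False
      then have "s * 1 \<le> s * s" using s by (intro mult_left_mono) auto
      moreover have "exp (- s) \<le> 1" using s by simp
      ultimately show ?thesis unfolding power2_eq_square by linarith
    qed
    with * show ?thesis by (simp add: s_def)
  qed simp
qed

text \<open>For \<open>sin \<theta> \<ge> 0\<close>, the only case needed, the unit square projects onto \<open>{lo \<theta>..hi \<theta>}\<close>. In the definition of
  \<open>chord\<close> the square is half-open, so that the subsquares partition it exactly.\<close>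

definition offset :: "real \<Rightarrow> nat \<times> nat \<Rightarrow> real" where
  "offset \<theta> Q = real (snd Q) * cos \<theta> - real (fst Q) * sin \<theta>"

definition lo :: "real \<Rightarrow> real" where "lo \<theta> = min 0 (cos \<theta>) - sin \<theta>"
definition hi :: "real \<Rightarrow> real" where "hi \<theta> = max 0 (cos \<theta>)"

definition hit :: "real \<Rightarrow> real \<Rightarrow> real" where
  "hit \<theta> t = indicator {lo \<theta>..hi \<theta>} t"

definition chord :: "real \<Rightarrow> real \<Rightarrow> real" where
  "chord \<theta> t = measure lborel {u. u * cos \<theta> - t * sin \<theta> \<in> {0..<1} \<and> t * cos \<theta> + u * sin \<theta> \<in> {0..<1}}"

lemma lo_hi_bounds:
  assumes "\<theta> \<in> {0..pi}"
  shows "lo \<theta> \<le> hi \<theta>" "hi \<theta> - lo \<theta> \<le> 2"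
proof -
  have "0 \<le> sin \<theta>" using assms by (auto intro: sin_ge_zero)
  then show "lo \<theta> \<le> hi \<theta>" "hi \<theta> - lo \<theta> \<le> 2"
    unfolding lo_def hi_def
    using sin_le_one[of \<theta>] cos_le_one[of \<theta>] cos_ge_minus_one[of \<theta>] by linarith+
qed

lemma hit_bounds: "0 \<le> hit \<theta> t" "hit \<theta> t \<le> 1"
  by (auto simp: hit_def indicator_def)

section \<open>The survival recursion and its linearisation\<close>

locale uniform_grid =
  fixes L :: nat and X :: "(nat \<times> nat) set pmf"
  assumes L2: "L \<ge> 2"
    and supp: "S \<in> set_pmf X \<Longrightarrow> S \<subseteq> {..<L} \<times> {..<L}"
    and unif: "Q \<in> {..<L} \<times> {..<L} \<Longrightarrow> measure_pmf.prob X {S. Q \<in> S} = 1 / real L"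
begin

abbreviation cells :: "(nat \<times> nat) set" where "cells \<equiv> {..<L} \<times> {..<L}"

lemma finite_supp: "finite (set_pmf X)"
  by (rule finite_subset[of _ "Pow cells"]) (use supp in auto)

lemma finite_sample: "S \<in> set_pmf X \<Longrightarrow> finite S"
  using supp finite_subset by blast

lemma integrable_X [simp]: "integrable (measure_pmf X) (f :: _ \<Rightarrow> real)"
  by (rule integrable_measure_pmf_finite[OF finite_supp])

lemma expectation_mono:
  fixes f g :: "_ \<Rightarrow> real"
  assumes "\<And>S. S \<in> set_pmf X \<Longrightarrow> f S \<le> g S"
  shows "measure_pmf.expectation X f \<le> measure_pmf.expectation X g"
  by (rule integral_mono_AE) (auto simp: AE_measure_pmf_iff assms)

lemma expectation_sum:
  fixes x :: "nat \<times> nat \<Rightarrow> real"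
  shows "measure_pmf.expectation X (\<lambda>S. \<Sum>D\<in>S. x D) = (\<Sum>D\<in>cells. x D) / L"
proof -
  have "measure_pmf.expectation X (\<lambda>S. \<Sum>D\<in>S. x D)
      = measure_pmf.expectation X (\<lambda>S. \<Sum>D\<in>cells. x D * indicator {S. D \<in> S} S)"
  proof (intro integral_cong_AE)
    show "AE S in X. (\<Sum>D\<in>S. x D) = (\<Sum>D\<in>cells. x D * indicator {S. D \<in> S} S)"
      unfolding AE_measure_pmf_iff
    proof
      fix S assume "S \<in> set_pmf X"
      then have S: "S \<subseteq> cells" by (rule supp)
      show "(\<Sum>D\<in>S. x D) = (\<Sum>D\<in>cells. x D * indicator {S. D \<in> S} S)"
        using S by (intro sum.mono_neutral_cong_left) auto
    qed
  qed auto
  also have "\<dots> = (\<Sum>D\<in>cells. x D * measure_pmf.prob X {S. D \<in> S})"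
    by (subst Bochner_Integration.integral_sum) auto
  also have "\<dots> = (\<Sum>D\<in>cells. x D) / L"
    by (simp add: unif sum_divide_distrib)
  finally show ?thesis .
qed

text \<open>\<open>zoom \<theta> D t\<close> is the parameter of the line \<open>t\<close> after rescaling the square \<open>D\<close> to the unit square.\<close>

definition zoom :: "real \<Rightarrow> nat \<times> nat \<Rightarrow> real \<Rightarrow> real" where
  "zoom \<theta> D t = real L * t - offset \<theta> D"

text \<open>Not a mean: there are \<open>L\<^sup>2\<close> terms but the divisor is
  \<open>L\<close>, the reciprocal of the selection probability of a cell. Hence this is the
  expected sum of \<open>f\<close> over the selected squares, as \<open>expectation_sum\<close>
  shows.\<close>

definition avg :: "real \<Rightarrow> (real \<Rightarrow> real) \<Rightarrow> real \<Rightarrow> real" where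
  "avg \<theta> f t = (\<Sum>D\<in>cells. f (zoom \<theta> D t)) / L"

text \<open>Probability that some selected square survives, if the line survives in each of them
  independently with probability \<open>f\<close> at the rescaled parameter.\<close>

definition surv_step :: "real \<Rightarrow> (real \<Rightarrow> real) \<Rightarrow> real \<Rightarrow> real" where
  "surv_step \<theta> f t = 1 - measure_pmf.expectation X (\<lambda>S. \<Prod>D\<in>S. 1 - f (zoom \<theta> D t))"

text \<open>A purely analytic iteration that unfolds the process from the root;
  \<open>expectation_shadow\<close> identifies it with the probability that the line meets the
  random set.\<close>

definition surv :: "real \<Rightarrow> nat \<Rightarrow> real \<Rightarrow> real" where
  "surv \<theta> n = (surv_step \<theta> ^^ n) (hit \<theta>)"

definition zooms :: "real \<Rightarrow> (nat \<times> nat) list \<Rightarrow> real \<Rightarrow> real" where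
  "zooms \<theta> ds t = fold (zoom \<theta>) ds t"

lemma surv_0 [simp]: "surv \<theta> 0 = hit \<theta>"
  and surv_Suc: "surv \<theta> (Suc n) = surv_step \<theta> (surv \<theta> n)"
  by (simp_all add: surv_def)

lemma zooms_simps [simp]: "zooms \<theta> [] t = t" "zooms \<theta> (d # ds) t = zooms \<theta> ds (zoom \<theta> d t)"
  by (simp_all add: zooms_def)

definition pair_prob :: "nat \<times> nat \<Rightarrow> nat \<times> nat \<Rightarrow> real" where
  "pair_prob A B = measure_pmf.prob X {S. A \<in> S \<and> B \<in> S}"

lemma pair_prob_le: "A \<in> cells \<Longrightarrow> pair_prob A B \<le> 1 / L"
  unfolding pair_prob_def
  by (subst unif[of A, symmetric]) (auto intro!: measure_pmf.finite_measure_mono)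

lemma surv_step_bounds:
  assumes "\<And>s. 0 \<le> f s \<and> f s \<le> 1"
  shows "0 \<le> surv_step \<theta> f t" "surv_step \<theta> f t \<le> 1"
proof -
  have "measure_pmf.expectation X (\<lambda>S. \<Prod>D\<in>S. 1 - f (zoom \<theta> D t)) \<le> measure_pmf.expectation X (\<lambda>S. 1)"
    using assms by (intro expectation_mono prod_le_1) auto
  then show "0 \<le> surv_step \<theta> f t" by (simp add: surv_step_def)
  have "0 \<le> measure_pmf.expectation X (\<lambda>S. \<Prod>D\<in>S. 1 - f (zoom \<theta> D t))"
    using assms by (intro Bochner_Integration.integral_nonneg prod_nonneg) auto
  then show "surv_step \<theta> f t \<le> 1" by (simp add: surv_step_def)
qed

lemma surv_step_eq:
  "surv_step \<theta> f t = measure_pmf.expectation X (\<lambda>S. 1 - (\<Prod>D\<in>S. 1 - f (zoom \<theta> D t)))"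
  by (simp add: surv_step_def)

lemma surv_step_mono:
  assumes "\<And>s. 0 \<le> f s \<and> f s \<le> g s \<and> g s \<le> 1"
  shows "surv_step \<theta> f t \<le> surv_step \<theta> g t"
  unfolding surv_step_eq
  using assms by (intro expectation_mono diff_left_mono prod_mono) auto

text \<open>The pair term is gained only on samples containing both squares, an event of probability
  \<open>pair_prob A B\<close>; elsewhere the plain union bound applies.\<close>

lemma surv_step_le_avg_pair:
  assumes f: "\<And>s. 0 \<le> f s \<and> f s \<le> 1" and AB: "A \<noteq> B"
  shows "surv_step \<theta> f t \<le> avg \<theta> f t - pair_prob A B * f (zoom \<theta> A t) * f (zoom \<theta> B t)"
proof -
  have "surv_step \<theta> f t \<le> measure_pmf.expectation X (\<lambda>S. (\<Sum>D\<in>S. f (zoom \<theta> D t))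
      - f (zoom \<theta> A t) * f (zoom \<theta> B t) * indicator {S. A \<in> S \<and> B \<in> S} S)"
    unfolding surv_step_eq
  proof (rule expectation_mono)
    fix S assume "S \<in> set_pmf X"
    then have "finite S" by (rule finite_sample)
    then show "1 - (\<Prod>D\<in>S. 1 - f (zoom \<theta> D t)) \<le> (\<Sum>D\<in>S. f (zoom \<theta> D t))
      - f (zoom \<theta> A t) * f (zoom \<theta> B t) * indicator {S. A \<in> S \<and> B \<in> S} S"
      using one_minus_prod_le_sum_pair[of S "\<lambda>D. f (zoom \<theta> D t)" A B]
        one_minus_prod_le_sum[of S "\<lambda>D. f (zoom \<theta> D t)"] f AB
      by (auto simp: indicator_def)
  qed
  also have "\<dots> = avg \<theta> f t - f (zoom \<theta> A t) * f (zoom \<theta> B t) * pair_prob A B"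
    by (subst Bochner_Integration.integral_diff) (auto simp: expectation_sum avg_def pair_prob_def)
  finally show ?thesis by (simp add: mult_ac)
qed

lemma surv_step_le_avg:
  assumes f: "\<And>s. 0 \<le> f s \<and> f s \<le> 1"
  shows "surv_step \<theta> f t \<le> avg \<theta> f t"
proof -
  have "0 \<le> pair_prob (0,0) (0,1) * f (zoom \<theta> (0,0) t) * f (zoom \<theta> (0,1) t)"
    using f by (auto simp: pair_prob_def intro!: mult_nonneg_nonneg)
  then show ?thesis
    using surv_step_le_avg_pair[of f "(0,0)" "(0,1)" \<theta> t] f by auto
qed

text \<open>Survival inside the single square \<open>D\<close>, selected with probability
  \<open>1 / L\<close>, already suffices.\<close>

lemma surv_step_ge:
  assumes f: "\<And>s. 0 \<le> f s \<and> f s \<le> 1" and D: "D \<in> cells"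
  shows "f (zoom \<theta> D t) / L \<le> surv_step \<theta> f t"
proof -
  have "f (zoom \<theta> D t) / L = measure_pmf.expectation X (\<lambda>S. f (zoom \<theta> D t) * indicator {S. D \<in> S} S)"
    using unif[OF D] by simp
  also have "\<dots> \<le> surv_step \<theta> f t"
    unfolding surv_step_eq
  proof (rule expectation_mono)
    fix S assume "S \<in> set_pmf X"
    then have fin: "finite S" by (rule finite_sample)
    show "f (zoom \<theta> D t) * indicator {S. D \<in> S} S \<le> 1 - (\<Prod>D\<in>S. 1 - f (zoom \<theta> D t))"
    proof (cases "D \<in> S")
      case True
      have "(\<Prod>D\<in>S. 1 - f (zoom \<theta> D t)) = (1 - f (zoom \<theta> D t)) * (\<Prod>D\<in>S-{D}. 1 - f (zoom \<theta> D t))"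
        using True fin by (simp add: prod.remove)
      also have "\<dots> \<le> (1 - f (zoom \<theta> D t)) * 1"
        using f by (intro mult_left_mono prod_le_1) auto
      finally show ?thesis using True by simp
    next
      case False
      have "(\<Prod>D\<in>S. 1 - f (zoom \<theta> D t)) \<le> 1" using f by (intro prod_le_1) auto
      then show ?thesis using False by simp
    qed
  qed
  finally show ?thesis .
qed

lemma surv_bounds: "0 \<le> surv \<theta> n t" "surv \<theta> n t \<le> 1"
proof -
  have "\<forall>t. 0 \<le> surv \<theta> n t \<and> surv \<theta> n t \<le> 1"
    by (induction n) (auto simp: surv_Suc hit_bounds intro!: surv_step_bounds)
  then show "0 \<le> surv \<theta> n t" "surv \<theta> n t \<le> 1" by auto
qed

lemma avg_mono: "(\<And>s. f s \<le> g s) \<Longrightarrow> avg \<theta> f t \<le> avg \<theta> g t"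
  unfolding avg_def by (intro divide_right_mono sum_mono) auto

lemma avg_pow_mono: "(\<And>s. f s \<le> g s) \<Longrightarrow> (avg \<theta> ^^ k) f t \<le> (avg \<theta> ^^ k) g t"
  by (induction k arbitrary: t) (auto intro!: avg_mono)

lemma avg_linear: "avg \<theta> (\<lambda>s. a * f s + b * g s) t = a * avg \<theta> f t + b * avg \<theta> g t"
  by (simp add: avg_def sum.distrib sum_distrib_left add_divide_distrib)

lemma avg_pow_linear:
  "(avg \<theta> ^^ k) (\<lambda>s. a * f s + b * g s) t = a * (avg \<theta> ^^ k) f t + b * (avg \<theta> ^^ k) g t"
proof (induction k arbitrary: t)
  case (Suc k)
  then have "(avg \<theta> ^^ k) (\<lambda>s. a * f s + b * g s) = (\<lambda>t. a * (avg \<theta> ^^ k) f t + b * (avg \<theta> ^^ k) g t)"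
    by auto
  then show ?case by (simp add: avg_linear)
qed simp

lemma avg_pow_nonneg: "(\<And>s. 0 \<le> f s) \<Longrightarrow> 0 \<le> (avg \<theta> ^^ k) f t"
  by (induction k arbitrary: t) (auto simp: avg_def intro!: divide_nonneg_nonneg sum_nonneg)

text \<open>The iterated average expands into a sum over digit sequences; nonnegativity allows
  keeping only the one for \<open>ds\<close>.\<close>

lemma avg_pow_ge:
  assumes "\<And>s. 0 \<le> f s" "set ds \<subseteq> cells"
  shows "f (zooms \<theta> ds t) / L ^ length ds \<le> (avg \<theta> ^^ length ds) f t"
  using assms(2)
proof (induction ds arbitrary: t)
  case (Cons d ds)
  have "f (zooms \<theta> (d # ds) t) / L ^ length (d # ds) = f (zooms \<theta> ds (zoom \<theta> d t)) / L ^ length ds / L"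
    by simp
  also have "\<dots> \<le> (avg \<theta> ^^ length ds) f (zoom \<theta> d t) / L"
    using Cons by (intro divide_right_mono) auto
  also have "\<dots> \<le> avg \<theta> ((avg \<theta> ^^ length ds) f) t"
    unfolding avg_def[of \<theta> "(avg \<theta> ^^ length ds) f"] using Cons.prems assms(1)
    by (intro divide_right_mono member_le_sum[of d cells "\<lambda>d. (avg \<theta> ^^ length ds) f (zoom \<theta> d t)"])
       (auto intro!: avg_pow_nonneg)
  finally show ?case by simp
qed simp

lemma surv_ge:
  assumes "set ds \<subseteq> cells"
  shows "surv \<theta> j (zooms \<theta> ds t) / L ^ length ds \<le> surv \<theta> (length ds + j) t"
  using assms
proof (induction ds arbitrary: t)
  case (Cons d ds)
  have "surv \<theta> j (zooms \<theta> (d # ds) t) / L ^ length (d # ds) = surv \<theta> j (zooms \<theta> ds (zoom \<theta> d t)) / L ^ length ds / L"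
    by simp
  also have "\<dots> \<le> surv \<theta> (length ds + j) (zoom \<theta> d t) / L"
    using Cons by (intro divide_right_mono) auto
  also have "\<dots> \<le> surv \<theta> (length (d # ds) + j) t"
    using Cons.prems by (auto simp: surv_Suc surv_bounds intro!: surv_step_ge)
  finally show ?case by simp
qed simp

text \<open>First-moment bound: the quadratic losses of the first \<open>k\<close> generations are
  discarded.\<close>

lemma surv_le_avg_pow: "surv \<theta> (k + j) t \<le> (avg \<theta> ^^ k) (surv \<theta> j) t"
proof (induction k arbitrary: t)
  case (Suc k)
  have "surv \<theta> (Suc k + j) t \<le> avg \<theta> (surv \<theta> (k + j)) t"
    by (auto simp: surv_Suc surv_bounds intro!: surv_step_le_avg)
  also have "\<dots> \<le> avg \<theta> ((avg \<theta> ^^ k) (surv \<theta> j)) t"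
    using Suc by (intro avg_mono)
  finally show ?case by simp
qed simp

end

subsection \<open>Chord length\<close>

lemma min_max_bounds:
  fixes c y n :: real
  assumes "0 \<le> y" "y \<le> n"
  shows "n * min 0 c \<le> y * c" "y * c \<le> n * max 0 c"
proof -
  consider "c \<ge> 0" | "c < 0" by linarith
  then have "n * min 0 c \<le> y * c \<and> y * c \<le> n * max 0 c"
    using assms by cases (auto simp: min_def max_def mult_right_mono mult_right_mono_neg mult_nonneg_nonpos)
  then show "n * min 0 c \<le> y * c" "y * c \<le> n * max 0 c" by auto
qed

lemma chord_set_measurable:
  fixes \<theta> t :: real
  shows "{u. u * cos \<theta> - t * sin \<theta> \<in> {0..<1} \<and> t * cos \<theta> + u * sin \<theta> \<in> {0..<1}} \<in> sets borel"
proof -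
  have 1: "(\<lambda>u. u * cos \<theta> - t * sin \<theta>) \<in> borel_measurable borel"
    and 2: "(\<lambda>u. t * cos \<theta> + u * sin \<theta>) \<in> borel_measurable borel"
    by (auto intro!: borel_measurable_continuous_onI continuous_intros)
  show ?thesis
    using sets.Int[OF measurable_sets[OF 1 atLeastLessThan_borel] measurable_sets[OF 2 atLeastLessThan_borel], of 0 1 0 1]
    by (simp add: vimage_def Int_def conj_assoc)
qed

lemma rotation_identities:
  fixes t u \<theta> :: real
  defines "x \<equiv> u * cos \<theta> - t * sin \<theta>" and "y \<equiv> t * cos \<theta> + u * sin \<theta>"
  shows "u = x * cos \<theta> + y * sin \<theta>" "t = y * cos \<theta> - x * sin \<theta>"
proof -
  have "(sin \<theta>)\<^sup>2 + (cos \<theta>)\<^sup>2 = 1" by simp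
  then show "u = x * cos \<theta> + y * sin \<theta>" "t = y * cos \<theta> - x * sin \<theta>"
    unfolding x_def y_def by algebra+
qed

text \<open>Rotating back expresses \<open>u\<close> and \<open>t\<close> through the coordinates of
  a point of the unit square; the crude range of \<open>u\<close> makes all chords finite and
  bounded by 3.\<close>

lemma chord_set_subset:
  assumes "\<theta> \<in> {0..pi}"
  assumes u: "u * cos \<theta> - t * sin \<theta> \<in> {0..<1}" "t * cos \<theta> + u * sin \<theta> \<in> {0..<1}"
  shows "u \<in> {-1..2}" "t \<in> {lo \<theta>..hi \<theta>}"
proof -
  define x y where "x = u * cos \<theta> - t * sin \<theta>" and "y = t * cos \<theta> + u * sin \<theta>"
  have s: "0 \<le> sin \<theta>" using assms by (auto intro: sin_ge_zero)
  have xy: "0 \<le> x" "x \<le> 1" "0 \<le> y" "y \<le> 1" using u by (auto simp: x_def y_def)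
  have u_eq: "u = x * cos \<theta> + y * sin \<theta>" and t_eq: "t = y * cos \<theta> - x * sin \<theta>"
    unfolding x_def y_def by (rule rotation_identities)+
  have ys: "0 \<le> y * sin \<theta>" "y * sin \<theta> \<le> 1" "0 \<le> x * sin \<theta>" "x * sin \<theta> \<le> sin \<theta>"
    using xy s by (auto intro: mult_le_one mult_left_le_one_le)
  show "u \<in> {-1..2}"
    using min_max_bounds[OF xy(1,2), of "cos \<theta>"] ys cos_le_one[of \<theta>] cos_ge_minus_one[of \<theta>] u_eq
    unfolding atLeastAtMost_iff by linarith
  show "t \<in> {lo \<theta>..hi \<theta>}"
    using min_max_bounds[OF xy(3,4), of "cos \<theta>"] ys t_eq
    unfolding atLeastAtMost_iff lo_def hi_def by linarith
qed

lemma chord_le_hit: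
  assumes "\<theta> \<in> {0..pi}"
  shows "chord \<theta> t \<le> 3 * hit \<theta> t"
proof (cases "t \<in> {lo \<theta>..hi \<theta>}")
  case True
  have "chord \<theta> t \<le> measure lborel {-1..2::real}"
    unfolding chord_def using chord_set_subset[OF assms] chord_set_measurable
    by (intro measure_mono_fmeasurable) (auto simp: fmeasurable_def)
  then show ?thesis using True by (simp add: hit_def)
next
  case False
  then have "{u. u * cos \<theta> - t * sin \<theta> \<in> {0..<1} \<and> t * cos \<theta> + u * sin \<theta> \<in> {0..<1}} = {}"
    using chord_set_subset[OF assms] by blast
  then have "chord \<theta> t = 0" unfolding chord_def by (simp only: measure_empty)
  then show ?thesis by (simp add: hit_bounds)
qed

lemma chord_nonneg: "0 \<le> chord \<theta> t"
  by (simp add: chord_def)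

text \<open>Half-open cells tile exactly: the only index that contributes is the integer part of
  \<open>L * x\<close>.\<close>

lemma sum_indicator_unit_cells:
  assumes "L \<ge> (1::nat)"
  shows "(\<Sum>a<L. indicator {0..<1} (real L * x - real a) :: real) = indicator {0..<1} x"
proof (cases "x \<in> {0..<1}")
  case True
  define k where "k = nat \<lfloor>real L * x\<rfloor>"
  have nn: "0 \<le> real L * x" "real L * x < real L" using True assms by auto
  then have k: "real k \<le> real L * x" "real L * x < real k + 1" unfolding k_def by linarith+
  then have "k < L" using nn by linarith
  have "(\<Sum>a<L. indicator {0..<1} (real L * x - real a) :: real) = (\<Sum>a<L. if a = k then 1 else 0)"
  proof (rule sum.cong[OF refl])
    fix a
    show "indicator {0..<1} (real L * x - real a) = (if a = k then 1 else (0::real))"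
      using k by (auto simp: indicator_def)
  qed
  then show ?thesis using \<open>k < L\<close> True by simp
next
  case False
  have "indicator {0..<1} (real L * x - real a) = (0::real)" if "a < L" for a
  proof -
    have "real a + 1 \<le> real L" using that by linarith
    moreover have "real L * x < 0 \<or> real L * x \<ge> real L"
      using False assms by (auto simp: mult_less_0_iff)
    ultimately have "real L * x - real a \<notin> {0..<1}" unfolding atLeastLessThan_iff by linarith
    then show ?thesis by simp
  qed
  then show ?thesis using False by simp
qed

lemma offset_bounds:
  assumes "\<theta> \<in> {0..pi}" "D \<in> {..<N} \<times> {..<N}"
  shows "(real N - 1) * lo \<theta> \<le> offset \<theta> D" "offset \<theta> D \<le> (real N - 1) * hi \<theta>"
proof -
  have s: "0 \<le> sin \<theta>" using assms by (auto intro: sin_ge_zero)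
  obtain a b where D: "D = (a, b)" "a < N" "b < N" using assms by auto
  have ab: "0 \<le> real a" "real a \<le> real N - 1" "0 \<le> real b" "real b \<le> real N - 1" using D by auto
  have "0 \<le> real a * sin \<theta>" "real a * sin \<theta> \<le> (real N - 1) * sin \<theta>"
    using ab s by (auto intro: mult_right_mono)
  then show "(real N - 1) * lo \<theta> \<le> offset \<theta> D" "offset \<theta> D \<le> (real N - 1) * hi \<theta>"
    using min_max_bounds[OF ab(3,4), of "cos \<theta>"]
    by (simp_all add: offset_def lo_def hi_def D algebra_simps)
qed

lemma shadow_subset:
  assumes "\<theta> \<in> {0..pi}" "D \<in> {..<N} \<times> {..<N}" "real N * t - offset \<theta> D \<in> {lo \<theta>..hi \<theta>}"
  shows "t \<in> {lo \<theta>..hi \<theta>}"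
proof -
  have "real N * lo \<theta> \<le> real N * t" "real N * t \<le> real N * hi \<theta>"
    using offset_bounds[OF assms(1,2)] assms(3) by (auto simp: algebra_simps)
  moreover have "real N > 0" using assms(2) by auto
  ultimately show ?thesis by auto
qed

context uniform_grid
begin

lemma hit_zoom:
  assumes "\<theta> \<in> {0..pi}" "D \<in> cells" "zoom \<theta> D t \<in> {lo \<theta>..hi \<theta>}"
  shows "t \<in> {lo \<theta>..hi \<theta>}"
  by (rule shadow_subset[OF assms(1,2) assms(3)[unfolded zoom_def]])

lemma surv_le_hit:
  assumes "\<theta> \<in> {0..pi}"
  shows "surv \<theta> n t \<le> hit \<theta> t"
proof (induction n arbitrary: t)
  case (Suc n)
  show ?case
  proof (cases "t \<in> {lo \<theta>..hi \<theta>}")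
    case True
    then show ?thesis using surv_bounds[of \<theta> "Suc n" t] by (simp add: hit_def)
  next
    case False
    have "surv \<theta> n (zoom \<theta> D t) = 0" if "D \<in> cells" for D
    proof -
      have "zoom \<theta> D t \<notin> {lo \<theta>..hi \<theta>}" using hit_zoom[OF assms that, of t] False by blast
      then have "hit \<theta> (zoom \<theta> D t) = 0" by (simp add: hit_def)
      then show ?thesis using Suc[of "zoom \<theta> D t"] surv_bounds[of \<theta> n "zoom \<theta> D t"] by simp
    qed
    then have "avg \<theta> (surv \<theta> n) t = 0" by (simp add: avg_def)
    moreover have "surv \<theta> (Suc n) t \<le> avg \<theta> (surv \<theta> n) t"
      by (auto simp: surv_Suc surv_bounds intro!: surv_step_le_avg)
    ultimately show ?thesis by (simp add: hit_bounds order_trans[OF _ hit_bounds(1)])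
  qed
qed simp

text \<open>The chord of the unit square is the disjoint union of its chords in the cells, and
  rescaling a cell to the unit square stretches its chord by \<open>L\<close>.\<close>

lemma avg_chord:
  assumes "\<theta> \<in> {0..pi}"
  shows "avg \<theta> (chord \<theta>) t = chord \<theta> t"
proof -
  define I :: "real \<Rightarrow> real" where "I = indicator {0..<1}"
  define g where "g t u = I (u * cos \<theta> - t * sin \<theta>) * I (t * cos \<theta> + u * sin \<theta>)" for t u
  have g_ind: "g t = indicator {u. u * cos \<theta> - t * sin \<theta> \<in> {0..<1} \<and> t * cos \<theta> + u * sin \<theta> \<in> {0..<1}}" for t
    by (auto simp: g_def I_def indicator_def)
  have chord: "chord \<theta> t = (\<integral>u. g t u \<partial>lborel)" for t
    unfolding chord_def g_ind by simp
  have g_int: "integrable lborel (g t)" for t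
    unfolding g_ind
  proof (rule integrable_real_indicator)
    have "emeasure lborel {u. u * cos \<theta> - t * sin \<theta> \<in> {0..<1} \<and> t * cos \<theta> + u * sin \<theta> \<in> {0..<1}}
        \<le> emeasure lborel {-1..2::real}"
      using chord_set_subset[OF assms, of _ t] by (intro emeasure_mono) auto
    then show "emeasure lborel {u. u * cos \<theta> - t * sin \<theta> \<in> {0..<1} \<and> t * cos \<theta> + u * sin \<theta> \<in> {0..<1}} < \<infinity>"
      by (rule le_less_trans) simp
  qed (simp add: chord_set_measurable)
  \<comment> \<open>\<open>e D\<close> is the position of the corner of \<open>D\<close> along the
    line, the companion of \<open>offset\<close> across it, so rescaling \<open>D\<close> sends
    \<open>u\<close> to \<open>L * u - e D\<close>.\<close>
  define e where "e D = real (fst D) * cos \<theta> + real (snd D) * sin \<theta>" for D :: "nat \<times> nat"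
  have shift: "g (zoom \<theta> D t) (- e D + real L * u)
      = I (real L * (u * cos \<theta> - t * sin \<theta>) - real (fst D)) * I (real L * (t * cos \<theta> + u * sin \<theta>) - real (snd D))"
    for D u
  proof -
    have sc: "(cos \<theta>)\<^sup>2 = 1 - (sin \<theta>)\<^sup>2" by (simp add: cos_squared_eq)
    have 1: "(- e D + real L * u) * cos \<theta> - zoom \<theta> D t * sin \<theta> = real L * (u * cos \<theta> - t * sin \<theta>) - real (fst D)"
      unfolding e_def zoom_def offset_def using sc by algebra
    have 2: "zoom \<theta> D t * cos \<theta> + (- e D + real L * u) * sin \<theta> = real L * (t * cos \<theta> + u * sin \<theta>) - real (snd D)"
      unfolding e_def zoom_def offset_def using sc by algebra
    show ?thesis unfolding g_def 1 2 ..
  qed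
  have "avg \<theta> (chord \<theta>) t = (\<Sum>D\<in>cells. real L * (\<integral>u. g (zoom \<theta> D t) (- e D + real L * u) \<partial>lborel)) / L"
    unfolding avg_def chord
  proof (intro arg_cong2[where f = divide] sum.cong refl)
    fix D
    show "(\<integral>u. g (zoom \<theta> D t) u \<partial>lborel) = real L * (\<integral>u. g (zoom \<theta> D t) (- e D + real L * u) \<partial>lborel)"
      using L2 by (subst lborel_integral_real_affine[where c = "real L" and t = "- e D"]) auto
  qed
  also have "\<dots> = (\<Sum>D\<in>cells. (\<integral>u. g (zoom \<theta> D t) (- e D + real L * u) \<partial>lborel))"
    using L2 by (simp add: sum_distrib_left[symmetric])
  also have "\<dots> = (\<integral>u. (\<Sum>D\<in>cells. g (zoom \<theta> D t) (- e D + real L * u)) \<partial>lborel)"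
    using L2 g_int by (intro Bochner_Integration.integral_sum[symmetric] lborel_integrable_real_affine) auto
  also have "(\<lambda>u. \<Sum>D\<in>cells. g (zoom \<theta> D t) (- e D + real L * u)) = g t"
  proof
    fix u
    have "(\<Sum>D\<in>cells. g (zoom \<theta> D t) (- e D + real L * u))
      = (\<Sum>a<L. I (real L * (u * cos \<theta> - t * sin \<theta>) - real a)) * (\<Sum>b<L. I (real L * (t * cos \<theta> + u * sin \<theta>) - real b))"
      unfolding shift sum_product by (simp add: sum.cartesian_product case_prod_beta)
    also have "\<dots> = g t u"
      unfolding I_def using L2 by (subst (1 2) sum_indicator_unit_cells) (auto simp: g_def I_def)
    finally show "(\<Sum>D\<in>cells. g (zoom \<theta> D t) (- e D + real L * u)) = g t u" .
  qed
  finally show ?thesis by (simp only: chord[of t])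
qed

lemma avg_pow_chord: "\<theta> \<in> {0..pi} \<Longrightarrow> (avg \<theta> ^^ k) (chord \<theta>) = chord \<theta>"
proof (induction k)
  case (Suc k)
  then show ?case using avg_chord[OF Suc.prems] by (auto intro: ext)
qed simp

end

subsection \<open>Pointwise and integrated bounds for the survival probability\<close>

context uniform_grid
begin

text \<open>The survival probabilities dominate \<open>c\<^sub>n chord\<close>, where \<open>c\<^sub>n\<close> satisfies \<open>c\<^sub>n\<^sub>+\<^sub>1 \<le> c\<^sub>n - 3 L\<^sup>2 c\<^sub>n\<^sup>2\<close>,
  because \<open>chord\<close> is a fixed point of the linearised recursion \<open>avg\<close>.\<close>

lemma surv_ge_chord:
  assumes "\<theta> \<in> {0..pi}"
  shows "chord \<theta> t / (6 * (real L)\<^sup>2 * (real n + 1)) \<le> surv \<theta> n t"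
proof (induction n arbitrary: t)
  case 0
  have "1 \<le> (real L)\<^sup>2" using L2 by simp
  then have "3 \<le> 6 * (real L)\<^sup>2" by linarith
  then have "chord \<theta> t / (6 * (real L)\<^sup>2) \<le> chord \<theta> t / 3"
    using chord_nonneg L2 by (intro divide_left_mono) auto
  also have "\<dots> \<le> hit \<theta> t" using chord_le_hit[OF assms, of t] by simp
  finally show ?case by simp
next
  case (Suc n)
  \<comment> \<open>\<open>B\<close> bounds the total rescaled chord length in a sample: at most
    \<open>L\<^sup>2\<close> squares, each with chord at most 3.\<close>
  define B where "B = 3 * (real L)\<^sup>2"
  have L: "4 \<le> (real L)\<^sup>2" using L2 power_mono[of 2 "real L" 2] by simp
  then have B: "B \<ge> 12" by (simp add: B_def)
  define c where "c = 1 / (2 * B * (real n + 1))"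
  have c: "c > 0" using B by (simp add: c_def)
  have chord3: "chord \<theta> s \<le> 3" for s using chord_le_hit[OF assms, of s] hit_bounds[of \<theta> s] by linarith
  have "24 * 1 \<le> 2 * B * (real n + 1)" using B by (intro mult_mono) simp_all
  then have "24 \<le> 2 * B * (real n + 1)" by simp
  then have "c \<le> 1 / 24" unfolding c_def by (intro divide_left_mono) auto
  have x: "0 \<le> c * chord \<theta> s \<and> c * chord \<theta> s \<le> 1" for s
  proof -
    have "c * chord \<theta> s \<le> (1/24) * 3" using chord3[of s] \<open>c \<le> 1/24\<close> c chord_nonneg by (intro mult_mono) auto
    then show ?thesis using c chord_nonneg by simp
  qed
  have IH: "c * chord \<theta> s \<le> surv \<theta> n s" for s using Suc[of s] by (simp add: c_def B_def)
  have "(c - B * c\<^sup>2) * chord \<theta> t = c * avg \<theta> (chord \<theta>) t - B * c\<^sup>2 * avg \<theta> (chord \<theta>) t"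
    using avg_chord[OF assms] by (simp add: algebra_simps)
  also have "\<dots> = measure_pmf.expectation X (\<lambda>S. c * (\<Sum>D\<in>S. chord \<theta> (zoom \<theta> D t)) - B * c\<^sup>2 * (\<Sum>D\<in>S. chord \<theta> (zoom \<theta> D t)))"
    by (simp add: expectation_sum avg_def)
  also have "\<dots> \<le> surv_step \<theta> (\<lambda>s. c * chord \<theta> s) t"
    unfolding surv_step_eq
  proof (rule expectation_mono)
    fix S assume S: "S \<in> set_pmf X"
    define s where "s = (\<Sum>D\<in>S. chord \<theta> (zoom \<theta> D t))"
    have s0: "s \<ge> 0" unfolding s_def by (intro sum_nonneg chord_nonneg)
    have "s \<le> (\<Sum>D\<in>cells. chord \<theta> (zoom \<theta> D t))"
      unfolding s_def using supp[OF S] by (intro sum_mono2) (auto simp: chord_nonneg)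
    also have "\<dots> \<le> real (card cells) * 3" using chord3 by (intro sum_bounded_above) auto
    finally have "s \<le> B" by (simp add: B_def power2_eq_square card_cartesian_product)
    \<comment> \<open>This makes the quadratic error linear in \<open>s\<close>, so that its
      expectation is again a multiple of \<open>chord\<close>.\<close>
    then have "s * s \<le> B * s" using s0 by (intro mult_right_mono)
    then have "c\<^sup>2 * (s * s) \<le> c\<^sup>2 * (B * s)" by (intro mult_left_mono) auto
    moreover have "c * s - (c * s)\<^sup>2 \<le> 1 - (\<Prod>D\<in>S. 1 - c * chord \<theta> (zoom \<theta> D t))"
      using one_minus_prod_ge_sum_minus_square[of S "\<lambda>D. c * chord \<theta> (zoom \<theta> D t)"] x
      by (simp add: s_def sum_distrib_left[symmetric])
    ultimately show "c * s - B * c\<^sup>2 * s \<le> 1 - (\<Prod>D\<in>S. 1 - c * chord \<theta> (zoom \<theta> D t))"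
      by (simp add: power2_eq_square algebra_simps)
  qed
  also have "\<dots> \<le> surv \<theta> (Suc n) t"
    unfolding surv_Suc using IH x surv_bounds by (intro surv_step_mono) auto
  finally have *: "(c - B * c\<^sup>2) * chord \<theta> t \<le> surv \<theta> (Suc n) t" .
  \<comment> \<open>With \<open>N = n + 1\<close> this reduces to
    \<open>2 * N\<^sup>2 \<le> (2 * N - 1) * (N + 1)\<close>, that is, to
    \<open>N \<ge> 1\<close>.\<close>
  have "1 / (2 * B * (real (Suc n) + 1)) \<le> c - B * c\<^sup>2"
  proof -
    define N where "N = real n + 1"
    have N: "N \<ge> 1" by (simp add: N_def)
    have "c - B * c\<^sup>2 = (1 / (2 * B)) * ((2 * N - 1) / (2 * N\<^sup>2))"
      unfolding c_def N_def[symmetric] using B N by (simp add: field_simps power2_eq_square)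
    also have "\<dots> \<ge> (1 / (2 * B)) * (1 / (N + 1))"
    proof (rule mult_left_mono)
      have "2 * N\<^sup>2 \<le> (2 * N - 1) * (N + 1)" using N by (simp add: algebra_simps power2_eq_square)
      then show "1 / (N + 1) \<le> (2 * N - 1) / (2 * N\<^sup>2)" using N by (simp add: divide_simps mult_ac)
    qed (use B in auto)
    finally show ?thesis by (simp add: N_def add_ac)
  qed
  then have "1 / (2 * B * (real (Suc n) + 1)) * chord \<theta> t \<le> (c - B * c\<^sup>2) * chord \<theta> t"
    by (intro mult_right_mono chord_nonneg)
  with * show ?case by (simp add: B_def)
qed

section \<open>Upper bound through weighted counts of passages\<close>

text \<open>One digit sequence of length \<open>K\<close> has coefficient \<open>1 / L ^ K\<close>
  in the \<open>K\<close>-fold average; lowering its weight from 1 to \<open>exp (- 1)\<close>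
  removes this amount.\<close>

definition damp :: "nat \<Rightarrow> real" where
  "damp K = (1 - exp (- 1)) / real L ^ K"

text \<open>\<open>tilted \<theta> ds i\<close> is the expected number of hit squares after \<open>i\<close> blocks of \<open>length ds\<close> levels,
  each weighted by \<open>exp (- G)\<close> where \<open>G\<close> counts the blocks whose digit sequence is \<open>ds\<close>.\<close>

primrec tilted :: "real \<Rightarrow> (nat \<times> nat) list \<Rightarrow> nat \<Rightarrow> real \<Rightarrow> real" where
  "tilted \<theta> ds 0 = hit \<theta>"
| "tilted \<theta> ds (Suc i) =
     (\<lambda>t. (avg \<theta> ^^ length ds) (tilted \<theta> ds i) t - damp (length ds) * tilted \<theta> ds i (zooms \<theta> ds t))"

text \<open>The subtracted term is at most the summand of the iterated average that belongs to
  \<open>ds\<close>.\<close>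

lemma tilted_nonneg:
  assumes "set ds \<subseteq> cells"
  shows "0 \<le> tilted \<theta> ds i t"
proof (induction i arbitrary: t)
  case 0
  then show ?case by (simp add: hit_bounds)
next
  case (Suc i)
  have "damp (length ds) * tilted \<theta> ds i (zooms \<theta> ds t) \<le> 1 / real L ^ length ds * tilted \<theta> ds i (zooms \<theta> ds t)"
    using Suc by (intro mult_right_mono) (auto simp: damp_def intro!: divide_right_mono)
  also have "\<dots> \<le> (avg \<theta> ^^ length ds) (tilted \<theta> ds i) t"
    using avg_pow_ge[of "tilted \<theta> ds i" ds \<theta> t] Suc assms by simp
  finally show ?case by simp
qed

text \<open>A Chernoff-type potential argument, with \<open>A'\<close> the square with digits
  \<open>A # ds\<close>. The term with \<open>exp m\<close> covers squares with few passages through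
  \<open>A'\<close>, the chord term pays for the others. The induction is over all \<open>m\<close>:
  the hypothesis is used at \<open>m - 1\<close> for the block through \<open>A'\<close> and at
  \<open>m\<close> for all others. The deficit \<open>V \<sigma>\<close> left by the smaller
  \<open>m\<close> is covered by the pair loss at \<open>A\<close>, \<open>B\<close>, because
  \<open>good\<close> guarantees a substantial chord in \<open>B\<close>.\<close>

lemma surv_block_bound:
  assumes th: "\<theta> \<in> {0..pi}"
    and AB: "A \<in> cells" "B \<in> cells" "A \<noteq> B" and ds: "set ds \<subseteq> cells"
    and p: "pair_prob A B > 0" and c0: "c0 > 0"
    and good: "\<And>t. zooms \<theta> ds (zoom \<theta> A t) \<in> {lo \<theta>..hi \<theta>} \<Longrightarrow> c0 \<le> chord \<theta> (zoom \<theta> B t)"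
  shows "m * surv \<theta> (i * Suc (length ds)) t
           \<le> chord \<theta> t / (pair_prob A B * c0 * L) + exp m * tilted \<theta> (A # ds) i t"
proof (induction i arbitrary: m t)
  case 0
  have "m * hit \<theta> t \<le> exp m * hit \<theta> t"
    using exp_ge_add_one_self[of m] by (intro mult_right_mono) (linarith, simp add: hit_bounds)
  moreover have "0 \<le> chord \<theta> t / (pair_prob A B * c0 * L)" using p c0 by (simp add: chord_nonneg)
  ultimately show ?case by simp
next
  case (Suc i)
  define C where "C = 1 / (pair_prob A B * c0 * L)"
  define q where "q = pair_prob A B"
  define k where "k = length ds"
  define j where "j = i * Suc k"
  define V where "V = surv \<theta> j"
  define E where "E = tilted \<theta> (A # ds) i"
  have L: "real L > 0" using L2 by simp
  have C: "C > 0" using p c0 L by (simp add: C_def)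
  have E0: "E s \<ge> 0" for s unfolding E_def using ds AB by (intro tilted_nonneg) auto
  have V0: "0 \<le> V s" "V s \<le> 1" for s by (auto simp: V_def surv_bounds)
  have target: "m * surv \<theta> (Suc k + j) t \<le> C * chord \<theta> t + exp m * tilted \<theta> (A # ds) (Suc i) t"
  \<comment> \<open>Negative \<open>m\<close> can arise from passing to \<open>m - 1\<close>; then
    the left side is nonpositive.\<close>
  proof (cases "m \<ge> 0")
    case False
    then have "m * surv \<theta> (Suc k + j) t \<le> 0" by (simp add: mult_nonpos_nonneg surv_bounds)
    moreover have "0 \<le> C * chord \<theta> t + exp m * tilted \<theta> (A # ds) (Suc i) t"
      using C chord_nonneg tilted_nonneg[of "A # ds" \<theta> "Suc i" t] ds AB
      by (intro add_nonneg_nonneg mult_nonneg_nonneg) auto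
    ultimately show ?thesis by linarith
  next
    case m: True
    have IH: "m * V s \<le> C * chord \<theta> s + exp m * E s" for m s
      using Suc[of m s] by (simp add: V_def j_def k_def C_def E_def)
    \<comment> \<open>\<open>F\<close> majorises \<open>m * V\<close> by the induction hypothesis;
      \<open>W\<close> and \<open>H\<close> are \<open>V\<close> and \<open>F\<close> averaged over
      the \<open>k\<close> levels below a cell, and \<open>\<sigma>\<close> is the parameter of the
      line seen from \<open>A'\<close>.\<close>
    define F where "F = (\<lambda>s. C * chord \<theta> s + exp m * E s)"
    define W where "W D = (avg \<theta> ^^ k) V (zoom \<theta> D t)" for D
    define H where "H D = (avg \<theta> ^^ k) F (zoom \<theta> D t)" for D
    define \<sigma> where "\<sigma> = zooms \<theta> ds (zoom \<theta> A t)"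
    define R where "R = cells - {A} - {B}"
    have split: "(\<Sum>D\<in>cells. f D) = f A + f B + (\<Sum>D\<in>R. f D)" for f :: "nat \<times> nat \<Rightarrow> real"
    proof -
      have "(\<Sum>D\<in>cells. f D) = f A + (\<Sum>D\<in>cells - {A}. f D)" using AB by (intro sum.remove) auto
      also have "(\<Sum>D\<in>cells - {A}. f D) = f B + (\<Sum>D\<in>R. f D)"
        unfolding R_def using AB by (intro sum.remove) auto
      finally show ?thesis by simp
    qed
    define sA where "sA = surv \<theta> (k + j) (zoom \<theta> A t)"
    have sA: "V \<sigma> / L ^ k \<le> sA" "sA \<le> 1" "0 \<le> sA"
      using surv_ge[OF ds, of \<theta> j "zoom \<theta> A t"] surv_bounds by (auto simp: V_def \<sigma>_def sA_def k_def)
    have q: "q \<le> 1 / L" "q > 0" using pair_prob_le[OF AB(1)] p by (auto simp: q_def)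
    \<comment> \<open>Keeps the coefficient of the \<open>B\<close> term nonnegative after the pair
      loss is subtracted, so upper bounds may be inserted there.\<close>
    have qs: "q * sA \<le> 1 / L"
    proof -
      have "q * sA \<le> q * 1" using sA q by (intro mult_left_mono) auto
      then show ?thesis using q by linarith
    qed
    have FV: "m * V s \<le> F s" for s unfolding F_def by (rule IH)
    have lin: "(avg \<theta> ^^ k) (\<lambda>s. F s - m * V s) s = (avg \<theta> ^^ k) F s - m * (avg \<theta> ^^ k) V s" for s
      using avg_pow_linear[of k \<theta> 1 F "- m" V s] by simp
    have HW: "0 \<le> H D - m * W D" for D
      using avg_pow_nonneg[of "\<lambda>s. F s - m * V s" k \<theta> "zoom \<theta> D t"] FV by (simp add: lin H_def W_def)
    \<comment> \<open>Only here is the hypothesis taken at \<open>m - 1\<close>: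
      \<open>exp (m - 1)\<close> produces the damping of \<open>E \<sigma>\<close>, and the missing
      unit of \<open>m\<close> produces \<open>- V \<sigma>\<close>.\<close>
    have HWA: "((1 - exp (- 1)) * exp m * E \<sigma> - V \<sigma>) / L ^ k \<le> H A - m * W A"
    proof -
      have "(m - 1) * V \<sigma> \<le> C * chord \<theta> \<sigma> + exp (m - 1) * E \<sigma>" by (rule IH)
      then have "(1 - exp (- 1)) * exp m * E \<sigma> - V \<sigma> \<le> F \<sigma> - m * V \<sigma>"
        by (simp add: F_def algebra_simps exp_diff exp_minus divide_simps)
      then have "((1 - exp (- 1)) * exp m * E \<sigma> - V \<sigma>) / L ^ k \<le> (F \<sigma> - m * V \<sigma>) / L ^ k"
        by (intro divide_right_mono) auto
      also have "\<dots> \<le> (avg \<theta> ^^ k) (\<lambda>s. F s - m * V s) (zoom \<theta> A t)"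
        unfolding \<sigma>_def k_def using FV by (intro avg_pow_ge[OF _ ds]) auto
      finally show ?thesis by (simp add: lin H_def W_def)
    qed
    \<comment> \<open>Since \<open>chord\<close> is fixed by \<open>avg\<close>, the chord in
      \<open>B\<close> survives the averaging undiminished.\<close>
    have HB: "C * chord \<theta> (zoom \<theta> B t) \<le> H B"
    proof -
      have "C * chord \<theta> (zoom \<theta> B t) = (avg \<theta> ^^ k) (\<lambda>s. C * chord \<theta> s + 0 * E s) (zoom \<theta> B t)"
        unfolding avg_pow_linear by (simp add: avg_pow_chord[OF th])
      also have "\<dots> \<le> H B"
        unfolding H_def F_def using E0 by (intro avg_pow_mono) auto
      finally show ?thesis .
    qed
    \<comment> \<open>\<open>C\<close> is chosen so that \<open>q * (C * c0) = 1 / L\<close>. If the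
      line misses \<open>A'\<close>, there is nothing to pay since
      \<open>V \<sigma> = 0\<close>.\<close>
    have gain: "V \<sigma> / L ^ Suc k \<le> q * sA * H B"
    proof (cases "\<sigma> \<in> {lo \<theta>..hi \<theta>}")
      case True
      then have ch: "c0 \<le> chord \<theta> (zoom \<theta> B t)" unfolding \<sigma>_def by (rule good)
      have "V \<sigma> / L ^ Suc k = q * (V \<sigma> / L ^ k) * (C * c0)"
        using p c0 L by (simp add: C_def q_def field_simps)
      also have "\<dots> \<le> q * sA * (C * c0)"
        by (rule mult_right_mono[OF mult_left_mono[OF sA(1)]]) (use q C c0 in auto)
      also have "\<dots> \<le> q * sA * H B"
      proof (rule mult_left_mono)
        show "C * c0 \<le> H B" using C by (intro order_trans[OF mult_left_mono[OF ch, of C] HB]) simp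
        show "0 \<le> q * sA" using q(2) sA(3) by (intro mult_nonneg_nonneg) simp_all
      qed
      finally show ?thesis .
    next
      case False
      then have "V \<sigma> = 0" using surv_le_hit[OF th, of j \<sigma>] V0[of \<sigma>] by (simp add: V_def hit_def)
      moreover have "0 \<le> H B" using HB C chord_nonneg[of \<theta> "zoom \<theta> B t"] by (auto intro: order_trans[rotated])
      ultimately show ?thesis using q sA by simp
    qed
    \<comment> \<open>The first level of the block keeps the pair loss, charged to the coefficient
      of \<open>B\<close>; the remaining \<open>k\<close> levels use the first-moment bound.\<close>
    have "surv \<theta> (Suc k + j) t \<le> avg \<theta> (surv \<theta> (k + j)) t - q * sA * surv \<theta> (k + j) (zoom \<theta> B t)"
      unfolding q_def sA_def using AB
      by (auto simp: surv_Suc surv_bounds intro!: surv_step_le_avg_pair)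
    also have "\<dots> = (\<Sum>D\<in>R. surv \<theta> (k + j) (zoom \<theta> D t)) / L + surv \<theta> (k + j) (zoom \<theta> A t) / L
        + (1 / L - q * sA) * surv \<theta> (k + j) (zoom \<theta> B t)"
      unfolding avg_def split by (simp add: add_divide_distrib algebra_simps)
    also have "\<dots> \<le> (\<Sum>D\<in>R. W D) / L + W A / L + (1 / L - q * sA) * W B"
      unfolding W_def V_def using qs
      by (intro add_mono divide_right_mono mult_left_mono sum_mono surv_le_avg_pow) auto
    finally have "m * surv \<theta> (Suc k + j) t \<le> m * ((\<Sum>D\<in>R. W D) / L + W A / L + (1 / L - q * sA) * W B)"
      using m by (intro mult_left_mono)
    also have "\<dots> = (\<Sum>D\<in>R. m * W D) / L + m * W A / L + (1 / L - q * sA) * (m * W B)"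
      by (simp add: algebra_simps sum_distrib_left)
    also have "\<dots> \<le> (\<Sum>D\<in>R. H D) / L + (H A - ((1 - exp (- 1)) * exp m * E \<sigma> - V \<sigma>) / L ^ k) / L + (1 / L - q * sA) * H B"
    proof (intro add_mono divide_right_mono mult_left_mono sum_mono)
      show "m * W D \<le> H D" for D using HW[of D] by simp
      then show "m * W B \<le> H B" .
      show "m * W A \<le> H A - ((1 - exp (- 1)) * exp m * E \<sigma> - V \<sigma>) / L ^ k" using HWA by linarith
    qed (use qs in auto)
    also have "\<dots> = (\<Sum>D\<in>cells. H D) / L
        - exp m * (damp (Suc k) * E \<sigma>) + V \<sigma> / L ^ Suc k - q * sA * H B"
      unfolding split by (simp add: damp_def add_divide_distrib diff_divide_distrib algebra_simps)
    also have "(\<Sum>D\<in>cells. H D) / L = C * chord \<theta> t + exp m * (avg \<theta> ^^ Suc k) E t"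
    proof -
      have "(\<Sum>D\<in>cells. H D) / L = (avg \<theta> ^^ Suc k) F t" by (simp add: H_def avg_def[of \<theta> "(avg \<theta> ^^ k) F"])
      also have "\<dots> = C * chord \<theta> t + exp m * (avg \<theta> ^^ Suc k) E t"
        unfolding F_def avg_pow_linear avg_pow_chord[OF th] ..
      finally show ?thesis .
    qed
    finally have "m * surv \<theta> (Suc k + j) t \<le> C * chord \<theta> t + exp m * (avg \<theta> ^^ Suc k) E t - exp m * (damp (Suc k) * E \<sigma>)"
      using gain by linarith
    then show ?thesis by (simp add: E_def k_def \<sigma>_def algebra_simps)
  qed
  then show ?case by (simp add: C_def j_def k_def add_ac)
qed

section \<open>Integration over the line parameter\<close>

lemma hit_integrable [simp]: "integrable lborel (hit \<theta>)"
  unfolding hit_def[abs_def] by (intro integrable_real_indicator) (auto simp: emeasure_lborel_Icc_eq)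

lemma hit_integral: "\<theta> \<in> {0..pi} \<Longrightarrow> (\<integral>t. hit \<theta> t \<partial>lborel) = hi \<theta> - lo \<theta>"
  unfolding hit_def using lo_hi_bounds by simp

lemma zoom_eq_affine: "zoom \<theta> D t = - offset \<theta> D + real L * t"
  by (simp add: zoom_def)

lemma integrable_zoom:
  assumes "integrable lborel (f :: real \<Rightarrow> real)"
  shows "integrable lborel (\<lambda>t. f (zoom \<theta> D t))"
  unfolding zoom_eq_affine using L2 assms by (intro lborel_integrable_real_affine) auto

lemma integral_zoom: "(\<integral>t. f (zoom \<theta> D t) \<partial>lborel) = (\<integral>t. f t \<partial>lborel :: real) / L"
  unfolding zoom_eq_affine
  using L2 lborel_integral_real_affine[of "real L" f "- offset \<theta> D"] by simp

lemma integral_zooms: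
  assumes "integrable lborel (f :: real \<Rightarrow> real)"
  shows "integrable lborel (\<lambda>t. f (zooms \<theta> ds t))"
    "(\<integral>t. f (zooms \<theta> ds t) \<partial>lborel) = (\<integral>t. f t \<partial>lborel) / real L ^ length ds"
proof -
  have "integrable lborel (\<lambda>t. f (zooms \<theta> ds t))
    \<and> (\<integral>t. f (zooms \<theta> ds t) \<partial>lborel) = (\<integral>t. f t \<partial>lborel) / real L ^ length ds"
  proof (induction ds)
    case Nil
    then show ?case using assms by simp
  next
    case (Cons d ds)
    then show ?case
      using integrable_zoom[of "\<lambda>t. f (zooms \<theta> ds t)" \<theta> d] integral_zoom[of "\<lambda>t. f (zooms \<theta> ds t)" \<theta> d]
      by simp
  qed
  then show "integrable lborel (\<lambda>t. f (zooms \<theta> ds t))"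
    "(\<integral>t. f (zooms \<theta> ds t) \<partial>lborel) = (\<integral>t. f t \<partial>lborel) / real L ^ length ds"
    by auto
qed

text \<open>Criticality: \<open>L\<^sup>2\<close> cells, the Jacobian \<open>1 / L\<close> and the
  selection probability \<open>1 / L\<close> balance.\<close>

lemma integral_avg:
  assumes "integrable lborel f"
  shows "integrable lborel (avg \<theta> f)" "(\<integral>t. avg \<theta> f t \<partial>lborel) = (\<integral>t. f t \<partial>lborel)"
proof -
  have int: "integrable lborel (\<lambda>t. f (zoom \<theta> D t))" for D by (rule integrable_zoom[OF assms])
  show "integrable lborel (avg \<theta> f)"
    unfolding avg_def[abs_def] using int by (intro integrable_divide Bochner_Integration.integrable_sum)
  have "(\<integral>t. avg \<theta> f t \<partial>lborel) = (\<Sum>D\<in>cells. (\<integral>t. f (zoom \<theta> D t) \<partial>lborel)) / L"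
    unfolding avg_def using int by (simp add: Bochner_Integration.integral_sum)
  also have "\<dots> = (\<integral>t. f t \<partial>lborel)"
    using L2 by (simp add: integral_zoom card_cartesian_product)
  finally show "(\<integral>t. avg \<theta> f t \<partial>lborel) = (\<integral>t. f t \<partial>lborel)" .
qed

lemma integral_avg_pow:
  assumes "integrable lborel f"
  shows "integrable lborel ((avg \<theta> ^^ k) f) \<and> (\<integral>t. (avg \<theta> ^^ k) f t \<partial>lborel) = (\<integral>t. f t \<partial>lborel)"
proof (induction k)
  case (Suc k)
  then show ?case using integral_avg[of "(avg \<theta> ^^ k) f" \<theta>] by simp
qed (use assms in simp)

lemma surv_measurable [measurable]: "surv \<theta> n \<in> borel_measurable borel"
proof (induction n)
  case 0
  then show ?case using borel_measurable_integrable[OF hit_integrable, of \<theta>] by simp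
next
  case (Suc n)
  note [measurable] = Suc
  have [measurable]: "zoom \<theta> D \<in> borel_measurable borel" for D
    unfolding zoom_def[abs_def] by measurable
  show ?case
    unfolding surv_Suc surv_step_def[abs_def] integral_measure_pmf_real[OF finite_supp]
    by (subst integral_measure_pmf_real[OF finite_supp]) (auto intro!: borel_measurable_diff borel_measurable_sum)
qed

lemma surv_integrable: "\<theta> \<in> {0..pi} \<Longrightarrow> integrable lborel (surv \<theta> n)"
  by (rule Bochner_Integration.integrable_bound[OF hit_integrable[of \<theta>]])
     (auto simp: surv_bounds hit_bounds surv_le_hit)

lemma surv_integral_antimono:
  assumes "\<theta> \<in> {0..pi}" "m \<le> n"
  shows "(\<integral>t. surv \<theta> n t \<partial>lborel) \<le> (\<integral>t. surv \<theta> m t \<partial>lborel)"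
proof -
  have "(\<integral>t. surv \<theta> n t \<partial>lborel) \<le> (\<integral>t. (avg \<theta> ^^ (n - m)) (surv \<theta> m) t \<partial>lborel)"
    using integral_avg_pow[OF surv_integrable[OF assms(1)]] surv_le_avg_pow[of \<theta> "n - m" m] assms
    by (intro integral_mono surv_integrable) auto
  then show ?thesis using integral_avg_pow[OF surv_integrable[OF assms(1)]] by simp
qed

lemma surv_integral_bounds:
  assumes "\<theta> \<in> {0..pi}"
  shows "0 \<le> (\<integral>t. surv \<theta> n t \<partial>lborel)" "(\<integral>t. surv \<theta> n t \<partial>lborel) \<le> 2"
  using surv_integral_antimono[OF assms, of 0 n] lo_hi_bounds[OF assms]
  by (auto simp: surv_bounds hit_integral[OF assms])

text \<open>Averaging preserves the mass, while zooming along \<open>ds\<close> divides it by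
  \<open>L ^ length ds\<close>; each block therefore loses a fixed proportion.\<close>

lemma tilted_integral:
  assumes "\<theta> \<in> {0..pi}"
  shows "integrable lborel (tilted \<theta> ds i)
    \<and> (\<integral>t. tilted \<theta> ds i t \<partial>lborel) = (1 - damp (length ds) / real L ^ length ds) ^ i * (hi \<theta> - lo \<theta>)"
proof (induction i)
  case 0
  then show ?case using hit_integral[OF assms] by simp
next
  case (Suc i)
  let ?f = "tilted \<theta> ds i"
  have int: "integrable lborel ?f" using Suc by simp
  show ?case
    using integral_avg_pow[OF int, where \<theta> = \<theta> and k = "length ds"] integral_zooms[OF int, where \<theta> = \<theta> and ds = ds] Suc
    by (simp add: algebra_simps)
qed

text \<open>Integrates \<open>surv_block_bound\<close> with \<open>m\<close> proportional to the
  number of blocks. The resulting constant involves neither \<open>\<theta>\<close> nor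
  \<open>n\<close>, which the compactness argument relies on.\<close>

lemma surv_integral_le:
  assumes th: "\<theta> \<in> {0..pi}"
    and AB: "A \<in> cells" "B \<in> cells" "A \<noteq> B" and ds: "set ds \<subseteq> cells"
    and p: "pair_prob A B > 0" and c0: "c0 > 0"
    and good: "\<And>t. zooms \<theta> ds (zoom \<theta> A t) \<in> {lo \<theta>..hi \<theta>} \<Longrightarrow> c0 \<le> chord \<theta> (zoom \<theta> B t)"
    and K: "K = Suc (length ds)" and n: "n \<ge> 1"
  shows "(\<integral>t. surv \<theta> n t \<partial>lborel)
    \<le> 2 * K * (1 + (6 / (pair_prob A B * c0 * L) + 2) / (damp K / real L ^ K)) / n"
proof -
  define y where "y = damp K / real L ^ K"
  define M where "M = 6 / (pair_prob A B * c0 * L) + 2"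
  have L: "real L \<ge> 1" using L2 by simp
  have M: "M > 0" using p c0 L by (simp add: M_def add_nonneg_pos)
  have LK: "real L ^ K \<ge> 1" using L by (simp add: one_le_power)
  have y: "0 < y" using L by (simp add: y_def damp_def)
  have "1 - exp (- 1) \<le> real L ^ K" using LK exp_gt_zero[of "- 1 :: real"] by linarith
  then have "damp K \<le> 1" using LK by (simp add: damp_def divide_le_eq)
  then have "y \<le> 1" using LK by (simp add: y_def divide_le_eq)
  have block: "y * i * (\<integral>t. surv \<theta> (i * K) t \<partial>lborel) \<le> M" for i :: nat
  proof -
    \<comment> \<open>As \<open>y\<close> is the proportion lost per block, this is the largest
      \<open>m\<close> for which \<open>(1 - y) ^ i \<le> exp (- y * i)\<close> still cancels
      \<open>exp m\<close>.\<close>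
    define m where "m = y * i"
    define C where "C = 3 / (pair_prob A B * c0 * L)"
    have C: "C > 0" using p c0 L by (simp add: C_def)
    have tint: "integrable lborel (tilted \<theta> (A # ds) i)" using tilted_integral[OF th] by blast
    have "m * (\<integral>t. surv \<theta> (i * K) t \<partial>lborel) = (\<integral>t. m * surv \<theta> (i * K) t \<partial>lborel)" by simp
    also have "\<dots> \<le> (\<integral>t. C * hit \<theta> t + exp m * tilted \<theta> (A # ds) i t \<partial>lborel)"
    proof (intro integral_mono)
      fix t
      have "m * surv \<theta> (i * K) t \<le> chord \<theta> t / (pair_prob A B * c0 * L) + exp m * tilted \<theta> (A # ds) i t"
        unfolding K by (rule surv_block_bound[OF th AB ds p c0 good])
      also have "chord \<theta> t / (pair_prob A B * c0 * L) \<le> 3 * hit \<theta> t / (pair_prob A B * c0 * L)"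
        using chord_le_hit[OF th, of t] p c0 by (intro divide_right_mono) auto
      finally show "m * surv \<theta> (i * K) t \<le> C * hit \<theta> t + exp m * tilted \<theta> (A # ds) i t"
        by (simp add: C_def)
    qed (use tint surv_integrable[OF th] in auto)
    also have "\<dots> = C * (hi \<theta> - lo \<theta>) + exp m * ((1 - y) ^ i * (hi \<theta> - lo \<theta>))"
      using tint tilted_integral[OF th, of "A # ds" i] hit_integral[OF th] by (simp add: y_def K)
    also have "\<dots> = (C + exp m * (1 - y) ^ i) * (hi \<theta> - lo \<theta>)" by (simp add: algebra_simps)
    also have "\<dots> \<le> (C + 1) * 2"
    proof (intro mult_mono add_left_mono)
      have "(1 - y) ^ i \<le> exp (- y) ^ i"
        using exp_ge_add_one_self[of "- y"] \<open>y \<le> 1\<close> by (intro power_mono) auto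
      also have "\<dots> = exp (- m)" by (simp add: m_def exp_of_nat_mult[symmetric] mult_ac)
      finally have "exp m * (1 - y) ^ i \<le> exp m * exp (- m)" by (intro mult_left_mono) auto
      then show "exp m * (1 - y) ^ i \<le> 1" by (simp add: exp_minus)
    qed (use C lo_hi_bounds[OF th] in auto)
    finally show ?thesis by (simp add: m_def M_def C_def)
  qed
  show ?thesis
  proof (cases "n < K")
    case True
    \<comment> \<open>Before the first block is complete the trivial bound 2 suffices, because
      \<open>K / n\<close> exceeds 1.\<close>
    have "(\<integral>t. surv \<theta> n t \<partial>lborel) \<le> 2 * 1" using surv_integral_bounds[OF th] by simp
    also have "\<dots> \<le> 2 * (K / n)" using True n by (intro mult_left_mono) auto
    also have "\<dots> \<le> 2 * (K / n) * (1 + M / y)"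
    proof -
      have "2 * (real K / real n) * 1 \<le> 2 * (K / n) * (1 + M / y)" using M y by (intro mult_left_mono) auto
      then show ?thesis by simp
    qed
    finally show ?thesis by (simp add: y_def M_def)
  next
    case False
    \<comment> \<open>Rounding \<open>n\<close> down to a multiple of \<open>K\<close> costs at most
      a factor 2, since \<open>i \<ge> 1\<close>.\<close>
    define i where "i = n div K"
    have "K > 0" by (simp add: K)
    then have i: "i \<ge> 1" using False by (simp add: i_def div_greater_zero_iff Suc_leI)
    have "n = i * K + n mod K" unfolding i_def by simp
    moreover have "n mod K < K" using \<open>K > 0\<close> by simp
    moreover have "K * 1 \<le> K * i" using i by (intro mult_left_mono) auto
    ultimately have "n \<le> 2 * (K * i)" using mult.commute[of i K] by linarith
    then have "n \<le> 2 * K * i" by simp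
    then have ni: "real n \<le> 2 * K * i" by (metis of_nat_le_iff of_nat_mult of_nat_numeral)
    have "(\<integral>t. surv \<theta> n t \<partial>lborel) \<le> (\<integral>t. surv \<theta> (i * K) t \<partial>lborel)"
      by (intro surv_integral_antimono[OF th]) (simp add: i_def)
    also have "\<dots> \<le> M / y / i" using block[of i] i y by (simp add: field_simps)
    also have "\<dots> \<le> 2 * K * (M / y) / n"
    proof -
      define Z where "Z = M / y"
      have "Z * n \<le> Z * (2 * K * i)" using M y ni by (intro mult_left_mono) (auto simp: Z_def)
      then show ?thesis unfolding Z_def[symmetric] using n i by (simp add: field_simps)
    qed
    also have "\<dots> \<le> 2 * K * (1 + M / y) / n"
      using M y by (intro divide_right_mono mult_left_mono) auto
    finally show ?thesis by (simp add: y_def M_def)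
  qed
qed

end

subsection \<open>The grid model and its projections\<close>

text \<open>The points \<open>(1 - l, y l)\<close> run along a diagonal of the unit square, chosen
  by the sign of \<open>cos \<theta>\<close> so that its end points project to
  \<open>lo \<theta>\<close> and \<open>hi \<theta>\<close>.\<close>

lemma unit_square_parametrisation:
  assumes "\<theta> \<in> {0..pi}"
  defines "y \<equiv> (\<lambda>l. if cos \<theta> \<ge> 0 then l else 1 - l :: real)"
  shows "lo \<theta> < hi \<theta>" "y l * cos \<theta> - (1 - l) * sin \<theta> = lo \<theta> + l * (hi \<theta> - lo \<theta>)"
proof -
  have s: "0 \<le> sin \<theta>" using assms by (auto intro: sin_ge_zero)
  have "sin \<theta> \<noteq> 0 \<or> cos \<theta> \<noteq> 0" using sin_zero_abs_cos_one[of \<theta>] by auto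
  then show "lo \<theta> < hi \<theta>" using s by (auto simp: lo_def hi_def min_def max_def)
  show "y l * cos \<theta> - (1 - l) * sin \<theta> = lo \<theta> + l * (hi \<theta> - lo \<theta>)"
    by (auto simp: y_def lo_def hi_def min_def max_def algebra_simps)
qed

lemma shadow_unit_square:
  assumes "\<theta> \<in> {0..pi}"
  shows "t \<in> {lo \<theta>..hi \<theta>} \<longleftrightarrow> (\<exists>x\<in>{0..1}. \<exists>y\<in>{0..1}. t = y * cos \<theta> - x * sin \<theta>)"
proof
  assume t: "t \<in> {lo \<theta>..hi \<theta>}"
  define l where "l = (t - lo \<theta>) / (hi \<theta> - lo \<theta>)"
  have lh: "lo \<theta> < hi \<theta>" by (rule unit_square_parametrisation[OF assms])
  have "l \<in> {0..1}" using t lh by (auto simp: l_def divide_le_eq_1)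
  moreover have "t = lo \<theta> + l * (hi \<theta> - lo \<theta>)" using lh by (simp add: l_def)
  ultimately show "\<exists>x\<in>{0..1}. \<exists>y\<in>{0..1}. t = y * cos \<theta> - x * sin \<theta>"
    using unit_square_parametrisation(2)[OF assms, of l]
    by (intro bexI[of _ "1 - l"] bexI[of _ "if cos \<theta> \<ge> 0 then l else 1 - l"]) auto
next
  assume "\<exists>x\<in>{0..1}. \<exists>y\<in>{0..1}. t = y * cos \<theta> - x * sin \<theta>"
  then obtain x y where xy: "0 \<le> x" "x \<le> 1" "0 \<le> y" "y \<le> 1" and t: "t = y * cos \<theta> - x * sin \<theta>" by auto
  have s: "0 \<le> sin \<theta>" using assms by (auto intro: sin_ge_zero)
  have "0 \<le> x * sin \<theta>" "x * sin \<theta> \<le> 1 * sin \<theta>"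
    using mult_nonneg_nonneg[OF xy(1) s] mult_right_mono[OF xy(2) s] by blast+
  then show "t \<in> {lo \<theta>..hi \<theta>}"
    using min_max_bounds[OF xy(3,4), of "cos \<theta>"] t unfolding lo_def hi_def atLeastAtMost_iff by linarith
qed

lemma proj_grid_square:
  assumes "\<theta> \<in> {0..pi}" "L > 0"
  shows "proj_theta \<theta> ` grid_square L n Q = {t. real L ^ n * t - offset \<theta> Q \<in> {lo \<theta>..hi \<theta>}}"
proof (intro set_eqI iffI)
  fix t assume "t \<in> proj_theta \<theta> ` grid_square L n Q"
  then obtain x y where xy: "real (fst Q) / real L ^ n \<le> x" "x \<le> (real (fst Q) + 1) / real L ^ n"
      "real (snd Q) / real L ^ n \<le> y" "y \<le> (real (snd Q) + 1) / real L ^ n"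
    and t: "t = - x * sin \<theta> + y * cos \<theta>"
    by (auto simp: grid_square_def proj_theta_def)
  have "real L ^ n * x - fst Q \<in> {0..1}" "real L ^ n * y - snd Q \<in> {0..1}"
    using xy assms by (auto simp: field_simps)
  moreover have "real L ^ n * t - offset \<theta> Q = (real L ^ n * y - snd Q) * cos \<theta> - (real L ^ n * x - fst Q) * sin \<theta>"
    by (simp add: t offset_def algebra_simps)
  ultimately show "t \<in> {t. real L ^ n * t - offset \<theta> Q \<in> {lo \<theta>..hi \<theta>}}"
    unfolding mem_Collect_eq shadow_unit_square[OF assms(1)] by blast
next
  fix t assume "t \<in> {t. real L ^ n * t - offset \<theta> Q \<in> {lo \<theta>..hi \<theta>}}"
  then obtain x y where xy: "x \<in> {0..1}" "y \<in> {0..1}" and t: "real L ^ n * t - offset \<theta> Q = y * cos \<theta> - x * sin \<theta>"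
    unfolding mem_Collect_eq shadow_unit_square[OF assms(1)] by blast
  have "proj_theta \<theta> ((x + fst Q) / real L ^ n, (y + snd Q) / real L ^ n)
      = ((y + snd Q) * cos \<theta> - (x + fst Q) * sin \<theta>) / real L ^ n"
    by (simp add: proj_theta_def diff_divide_distrib)
  also have "(y + snd Q) * cos \<theta> - (x + fst Q) * sin \<theta> = real L ^ n * t"
    using t by (simp add: offset_def algebra_simps)
  finally have "t = proj_theta \<theta> ((x + fst Q) / real L ^ n, (y + snd Q) / real L ^ n)"
    using assms(2) by simp
  moreover have "((x + fst Q) / real L ^ n, (y + snd Q) / real L ^ n) \<in> grid_square L n Q"
    using xy assms(2) by (auto simp: grid_square_def field_simps)
  ultimately show "t \<in> proj_theta \<theta> ` grid_square L n Q" by blast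
qed

lemma child_index_inject:
  assumes "Q \<in> {..<L} \<times> {..<L}" "Q' \<in> {..<L} \<times> {..<L}"
  shows "child_index L R Q = child_index L R' Q' \<longleftrightarrow> R = R' \<and> Q = Q'"
proof -
  have *: "a = a' \<and> i = i'" if "L * a + i = L * a' + i'" "i < L" "i' < L" for a a' i i' :: nat
  proof -
    have "(L * a + i) div L = a" "(L * a' + i') div L = a'" using that(2,3) by auto
    then have "a = a'" using that(1) by simp
    then show ?thesis using that(1) by simp
  qed
  show ?thesis
    using assms *[of "fst R" "fst Q" "fst R'" "fst Q'"] *[of "snd R" "snd Q" "snd R'" "snd Q'"]
    by (auto simp: child_index_def prod_eq_iff)
qed

section \<open>The random sets and the law of their projections\<close>

context uniform_grid
begin

text \<open>The indicator of the projection for finite \<open>S\<close>, written as a product so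
  that independence applies factor by factor.\<close>

definition shadow :: "nat \<Rightarrow> (nat \<times> nat) set \<Rightarrow> real \<Rightarrow> real \<Rightarrow> real" where
  "shadow n S \<theta> t = 1 - (\<Prod>Q\<in>S. 1 - hit \<theta> (real L ^ n * t - offset \<theta> Q))"

lemma set_refine_step:
  assumes "finite S" "S' \<in> set_pmf (refine_step L X S)"
  obtains f where "S' = (\<Union>R\<in>S. child_index L R ` f R)" "\<And>R. R \<in> S \<Longrightarrow> f R \<in> set_pmf X"
  using assms by (auto simp: refine_step_def set_Pi_pmf PiE_dflt_def simp del: split_paired_All)

lemma set_grid_sets:
  "S \<in> set_pmf (grid_sets L X n) \<Longrightarrow> S \<subseteq> {..<L ^ n} \<times> {..<L ^ n}"
proof (induction n arbitrary: S)
  case (Suc n)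
  then obtain S0 where S0: "S0 \<in> set_pmf (grid_sets L X n)" "S \<in> set_pmf (refine_step L X S0)" by auto
  have sub: "S0 \<subseteq> {..<L ^ n} \<times> {..<L ^ n}" by (rule Suc.IH[OF S0(1)])
  then have "finite S0" by (rule finite_subset) auto
  then obtain f where f: "S = (\<Union>R\<in>S0. child_index L R ` f R)" "\<And>R. R \<in> S0 \<Longrightarrow> f R \<in> set_pmf X"
    using S0(2) by (rule set_refine_step) blast
  have *: "L * a + i < L * L ^ n" if "a < L ^ n" "i < L" for a i
  proof -
    have "L * (a + 1) \<le> L * L ^ n" using that by (intro mult_left_mono) auto
    then show ?thesis using that by simp
  qed
  show ?case
  proof
    fix Q assume "Q \<in> S"
    then obtain R D where R: "R \<in> S0" "D \<in> f R" "Q = child_index L R D" using f by auto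
    have "D \<in> cells" using f(2)[OF R(1)] supp R(2) by blast
    then show "Q \<in> {..<L ^ Suc n} \<times> {..<L ^ Suc n}"
      using R sub by (auto simp: child_index_def mem_Times_iff intro!: *)
  qed
qed auto

lemma finite_set_grid_sets: "finite (set_pmf (grid_sets L X n))"
  by (rule finite_subset[of _ "Pow ({..<L ^ n} \<times> {..<L ^ n})"]) (use set_grid_sets in auto)

lemma finite_grid_sets: "S \<in> set_pmf (grid_sets L X n) \<Longrightarrow> finite S"
  using set_grid_sets by (rule finite_subset) auto

text \<open>Distinct parents have disjoint sets of children, so the product splits over the parents,
  which are refined independently.\<close>

lemma expectation_prod_refine_step:
  assumes S: "finite S" and w: "\<And>Q. 0 \<le> w Q"
  shows "measure_pmf.expectation (refine_step L X S) (\<lambda>S'. \<Prod>Q\<in>S'. w Q :: real)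
    = (\<Prod>R\<in>S. measure_pmf.expectation X (\<lambda>f. \<Prod>Q\<in>f. w (child_index L R Q)))"
proof -
  have "measure_pmf.expectation (refine_step L X S) (\<lambda>S'. \<Prod>Q\<in>S'. w Q)
    = measure_pmf.expectation (Pi_pmf S {} (\<lambda>_. X)) (\<lambda>f. \<Prod>Q\<in>(\<Union>R\<in>S. child_index L R ` f R). w Q)"
    by (simp add: refine_step_def)
  also have "\<dots> = measure_pmf.expectation (Pi_pmf S {} (\<lambda>_. X)) (\<lambda>f. \<Prod>R\<in>S. \<Prod>Q\<in>f R. w (child_index L R Q))"
  proof (intro integral_cong_AE)
    show "AE f in Pi_pmf S {} (\<lambda>_. X). (\<Prod>Q\<in>(\<Union>R\<in>S. child_index L R ` f R). w Q) = (\<Prod>R\<in>S. \<Prod>Q\<in>f R. w (child_index L R Q))"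
      unfolding AE_measure_pmf_iff
    proof
      fix f assume "f \<in> set_pmf (Pi_pmf S {} (\<lambda>_. X))"
      then have f: "f R \<in> set_pmf X" if "R \<in> S" for R
        using that S by (auto simp: set_Pi_pmf PiE_dflt_def simp del: split_paired_All)
      have sub: "f R \<subseteq> cells" "finite (f R)" if "R \<in> S" for R
        using f[OF that] supp finite_sample by auto
      have "(\<Prod>Q\<in>(\<Union>R\<in>S. child_index L R ` f R). w Q) = (\<Prod>R\<in>S. \<Prod>Q\<in>child_index L R ` f R. w Q)"
      proof (rule prod.UNION_disjoint; (intro ballI impI)?)
        fix R R' assume R: "R \<in> S" "R' \<in> S" "R \<noteq> R'"
        show "child_index L R ` f R \<inter> child_index L R' ` f R' = {}"
        proof (rule ccontr)
          assume "child_index L R ` f R \<inter> child_index L R' ` f R' \<noteq> {}"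
          then obtain Q Q' where Q: "Q \<in> f R" "Q' \<in> f R'" "child_index L R Q = child_index L R' Q'" by blast
          then show False using child_index_inject[of Q L Q' R R'] sub R by blast
        qed
      qed (use S sub in auto)
      also have "\<dots> = (\<Prod>R\<in>S. \<Prod>Q\<in>f R. w (child_index L R Q))"
      proof (rule prod.cong[OF refl])
        fix R assume R: "R \<in> S"
        have "inj_on (child_index L R) (f R)"
          using child_index_inject sub[OF R] by (intro inj_onI) blast
        then show "(\<Prod>Q\<in>child_index L R ` f R. w Q) = (\<Prod>Q\<in>f R. w (child_index L R Q))"
          by (simp add: prod.reindex)
      qed
      finally show "(\<Prod>Q\<in>(\<Union>R\<in>S. child_index L R ` f R). w Q) = (\<Prod>R\<in>S. \<Prod>Q\<in>f R. w (child_index L R Q))" .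
    qed
  qed auto
  also have "\<dots> = (\<Prod>R\<in>S. measure_pmf.expectation X (\<lambda>f. \<Prod>Q\<in>f. w (child_index L R Q)))"
    by (rule expectation_prod_Pi_pmf[OF S]) (simp_all add: prod_nonneg w)
  finally show ?thesis .
qed

text \<open>\<open>grid_sets\<close> grows at the leaves while \<open>surv\<close> unfolds at the
  root. Integrating out the last refinement turns \<open>surv \<theta> j\<close> at level
  \<open>n + 1\<close> into \<open>surv \<theta> (Suc j)\<close> at level \<open>n\<close>, so the
  induction must leave \<open>j\<close> free.\<close>

lemma expectation_miss:
  "measure_pmf.expectation (grid_sets L X n) (\<lambda>S. \<Prod>Q\<in>S. 1 - surv \<theta> j (real L ^ n * t - offset \<theta> Q))
    = 1 - surv \<theta> (n + j) t"
proof (induction n arbitrary: j)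
  case 0
  then show ?case by (simp add: offset_def)
next
  case (Suc n)
  let ?G = "grid_sets L X n"
  let ?w = "\<lambda>Q. 1 - surv \<theta> j (real L ^ Suc n * t - offset \<theta> Q)"
  have "measure_pmf.expectation (grid_sets L X (Suc n)) (\<lambda>S. prod ?w S)
      = (\<Sum>S\<in>set_pmf ?G. pmf ?G S *\<^sub>R measure_pmf.expectation (refine_step L X S) (\<lambda>S. prod ?w S))"
    unfolding grid_sets.simps
  proof (rule pmf_expectation_bind[OF finite_set_grid_sets _ order_refl])
    fix S assume "S \<in> set_pmf ?G"
    then have "S \<in> set_pmf (grid_sets L X n)" "set_pmf (refine_step L X S) \<subseteq> set_pmf (grid_sets L X (Suc n))"
      by auto
    then show "finite (set_pmf (refine_step L X S))"
      using finite_set_grid_sets finite_subset by blast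
  qed
  also have "\<dots> = (\<Sum>S\<in>set_pmf ?G. pmf ?G S *\<^sub>R (\<Prod>R\<in>S. 1 - surv \<theta> (Suc j) (real L ^ n * t - offset \<theta> R)))"
  proof (rule sum.cong[OF refl])
    fix S assume "S \<in> set_pmf ?G"
    then have fin: "finite S" by (rule finite_grid_sets)
    have "measure_pmf.expectation (refine_step L X S) (\<lambda>S. prod ?w S)
      = (\<Prod>R\<in>S. measure_pmf.expectation X (\<lambda>f. \<Prod>Q\<in>f. ?w (child_index L R Q)))"
      by (rule expectation_prod_refine_step[OF fin]) (simp add: surv_bounds)
    also have "\<dots> = (\<Prod>R\<in>S. 1 - surv \<theta> (Suc j) (real L ^ n * t - offset \<theta> R))"
    proof (rule prod.cong[OF refl])
      fix R
      have "real L ^ Suc n * t - offset \<theta> (child_index L R Q) = zoom \<theta> Q (real L ^ n * t - offset \<theta> R)" for Q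
        by (simp add: zoom_def offset_def child_index_def algebra_simps)
      then show "measure_pmf.expectation X (\<lambda>f. \<Prod>Q\<in>f. ?w (child_index L R Q)) = 1 - surv \<theta> (Suc j) (real L ^ n * t - offset \<theta> R)"
        by (simp add: surv_Suc surv_step_def)
    qed
    finally show "pmf ?G S *\<^sub>R measure_pmf.expectation (refine_step L X S) (\<lambda>S. prod ?w S)
      = pmf ?G S *\<^sub>R (\<Prod>R\<in>S. 1 - surv \<theta> (Suc j) (real L ^ n * t - offset \<theta> R))" by simp
  qed
  also have "\<dots> = measure_pmf.expectation ?G (\<lambda>S. \<Prod>R\<in>S. 1 - surv \<theta> (Suc j) (real L ^ n * t - offset \<theta> R))"
    by (subst integral_measure_pmf_real[OF finite_set_grid_sets]) (auto simp: mult_ac)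
  also have "\<dots> = 1 - surv \<theta> (Suc n + j) t"
    using Suc.IH[of "Suc j"] by simp
  finally show ?case .
qed

lemma expectation_shadow:
  "(\<Sum>S\<in>set_pmf (grid_sets L X n). pmf (grid_sets L X n) S * shadow n S \<theta> t) = surv \<theta> n t"
proof -
  have "(\<Sum>S\<in>set_pmf (grid_sets L X n). pmf (grid_sets L X n) S * shadow n S \<theta> t)
    = measure_pmf.expectation (grid_sets L X n) (\<lambda>S. shadow n S \<theta> t)"
    by (subst integral_measure_pmf_real[OF finite_set_grid_sets]) (auto simp: mult_ac)
  also have "\<dots> = 1 - measure_pmf.expectation (grid_sets L X n) (\<lambda>S. \<Prod>Q\<in>S. 1 - surv \<theta> 0 (real L ^ n * t - offset \<theta> Q))"
    unfolding shadow_def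
    by (subst Bochner_Integration.integral_diff) (auto intro: integrable_measure_pmf_finite finite_set_grid_sets)
  also have "\<dots> = surv \<theta> n t" unfolding expectation_miss by simp
  finally show ?thesis .
qed

lemma shadow_eq_indicator:
  assumes "\<theta> \<in> {0..pi}" "finite S"
  shows "shadow n S \<theta> t = indicator (proj_theta \<theta> ` grid_union L n S) t"
proof -
  have L: "L > 0" using L2 by simp
  have "proj_theta \<theta> ` grid_union L n S = (\<Union>Q\<in>S. {t. real L ^ n * t - offset \<theta> Q \<in> {lo \<theta>..hi \<theta>}})"
    unfolding grid_union_def image_UN proj_grid_square[OF assms(1) L] ..
  moreover have "shadow n S \<theta> t = indicator (\<Union>Q\<in>S. {t. real L ^ n * t - offset \<theta> Q \<in> {lo \<theta>..hi \<theta>}}) t"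
  proof (cases "\<exists>Q\<in>S. real L ^ n * t - offset \<theta> Q \<in> {lo \<theta>..hi \<theta>}")
    case True
    then obtain Q where "Q \<in> S" "real L ^ n * t - offset \<theta> Q \<in> {lo \<theta>..hi \<theta>}" by blast
    then have "\<exists>Q\<in>S. 1 - hit \<theta> (real L ^ n * t - offset \<theta> Q) = 0"
      by (intro bexI[of _ Q]) (simp_all add: hit_def)
    then have "(\<Prod>Q\<in>S. 1 - hit \<theta> (real L ^ n * t - offset \<theta> Q)) = 0"
      using assms(2) by (intro prod_zero)
    then show ?thesis using True by (simp add: shadow_def indicator_def)
  next
    case False
    then have "(\<Prod>Q\<in>S. 1 - hit \<theta> (real L ^ n * t - offset \<theta> Q)) = 1"
      by (intro prod.neutral) (auto simp: hit_def indicator_def)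
    then show ?thesis using False by (simp add: shadow_def)
  qed
  ultimately show ?thesis by simp
qed

lemma shadow_measurable: "(\<lambda>(\<theta>, t). shadow n S \<theta> t) \<in> borel_measurable (borel \<Otimes>\<^sub>M borel)"
proof -
  have [measurable]: "lo \<in> borel_measurable borel" "hi \<in> borel_measurable borel"
    "(\<lambda>\<theta>. offset \<theta> Q) \<in> borel_measurable borel" for Q
    unfolding lo_def[abs_def] hi_def[abs_def] offset_def
    by (auto intro!: borel_measurable_continuous_onI continuous_intros)
  show ?thesis
    unfolding shadow_def hit_def indicator_def atLeastAtMost_iff by measurable
qed

lemma compact_projection:
  assumes "finite S"
  shows "compact (proj_theta \<theta> ` grid_union L n S)"
proof (rule compact_continuous_image)
  show "continuous_on (grid_union L n S) (proj_theta \<theta>)"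
    unfolding proj_theta_def[abs_def] by (intro continuous_intros)
  show "compact (grid_union L n S)"
    unfolding grid_union_def grid_square_def using assms by (intro compact_UN compact_Times compact_Icc) auto
qed

lemma measure_projection:
  assumes "\<theta> \<in> {0..pi}" "finite S"
  shows "measure lebesgue (proj_theta \<theta> ` grid_union L n S) = (\<integral>t. shadow n S \<theta> t \<partial>lborel)"
proof -
  have "proj_theta \<theta> ` grid_union L n S \<in> sets borel"
    using compact_projection[OF assms(2)] compact_imp_closed by (intro borel_closed) blast
  then show ?thesis unfolding shadow_eq_indicator[OF assms] by simp
qed

lemma shadow_integrable:
  assumes "\<theta> \<in> {0..pi}" "finite S"
  shows "integrable lborel (shadow n S \<theta>)"
  unfolding shadow_eq_indicator[OF assms, abs_def]
  using compact_projection[OF assms(2)]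
  by (intro integrable_real_indicator emeasure_bounded_finite) (auto simp: compact_imp_closed compact_imp_bounded)

lemma shadow_integral_bounds:
  assumes "\<theta> \<in> {0..pi}" "S \<subseteq> {..<L ^ n} \<times> {..<L ^ n}"
  shows "0 \<le> (\<integral>t. shadow n S \<theta> t \<partial>lborel)" "(\<integral>t. shadow n S \<theta> t \<partial>lborel) \<le> 2"
proof -
  have fin: "finite S" using assms(2) by (rule finite_subset) auto
  show "0 \<le> (\<integral>t. shadow n S \<theta> t \<partial>lborel)"
    using shadow_eq_indicator[OF assms(1) fin] by (intro Bochner_Integration.integral_nonneg) simp
  have "shadow n S \<theta> t \<le> hit \<theta> t" for t
  proof (cases "t \<in> {lo \<theta>..hi \<theta>}")
    case False
    have "hit \<theta> (real L ^ n * t - offset \<theta> Q) = 0" if "Q \<in> S" for Q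
    proof -
      have "Q \<in> {..<L ^ n} \<times> {..<L ^ n}" using assms(2) that by blast
      then have "real L ^ n * t - offset \<theta> Q \<notin> {lo \<theta>..hi \<theta>}"
        using shadow_subset[OF assms(1), of Q "L ^ n" t] False by auto
      then show ?thesis by (simp add: hit_def)
    qed
    then show ?thesis by (simp add: shadow_def hit_bounds)
  qed (simp add: shadow_eq_indicator[OF assms(1) fin] hit_def indicator_def)
  then have "(\<integral>t. shadow n S \<theta> t \<partial>lborel) \<le> (\<integral>t. hit \<theta> t \<partial>lborel)"
    by (intro integral_mono shadow_integrable assms(1) fin) auto
  then show "(\<integral>t. shadow n S \<theta> t \<partial>lborel) \<le> 2"
    using lo_hi_bounds[OF assms(1)] by (simp add: hit_integral[OF assms(1)])
qed

text \<open>\<open>Fav\<close> is a gauge integral, meaningless without integrability; this comes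
  from joint measurability of \<open>shadow\<close> and the bound 2 on its integral.\<close>

lemma Fav_has_integral:
  assumes "S \<in> set_pmf (grid_sets L X n)"
  shows "((\<lambda>\<theta>. \<integral>t. shadow n S \<theta> t \<partial>lborel) has_integral Fav (grid_union L n S)) {0..pi}"
proof -
  have fin: "finite S" using assms by (rule finite_grid_sets)
  let ?f = "\<lambda>\<theta>. \<integral>t. shadow n S \<theta> t \<partial>lborel"
  have [measurable]: "?f \<in> borel_measurable borel"
    using shadow_measurable[of n S] by (intro lborel.borel_measurable_lebesgue_integral) simp
  have "set_integrable lborel {0..pi} ?f"
    unfolding set_integrable_def
  proof (rule Bochner_Integration.integrable_bound)
    show "integrable lborel (\<lambda>\<theta>. 2 * indicator {0..pi} \<theta> :: real)"
      by (intro integrable_mult_right integrable_real_indicator) (auto simp: emeasure_lborel_Icc_eq)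
    show "AE \<theta> in lborel. norm (indicator {0..pi} \<theta> *\<^sub>R ?f \<theta>) \<le> norm (2 * indicator {0..pi} \<theta> :: real)"
      using shadow_integral_bounds[OF _ set_grid_sets[OF assms]] by (auto simp: indicator_def)
  qed measurable
  then have "?f integrable_on {0..pi}" by (rule set_borel_integral_eq_integral)
  then have "(?f has_integral integral {0..pi} ?f) {0..pi}" by (rule integrable_integral)
  also have "integral {0..pi} ?f = Fav (grid_union L n S)"
    unfolding Fav_def by (rule integral_cong) (simp add: measure_projection[OF _ fin])
  finally show ?thesis .
qed

text \<open>The support of \<open>grid_sets L X n\<close> is finite, so the interchange of
  expectation and integrals is linearity over a finite sum.\<close>

lemma expectation_Fav:
  "((\<lambda>\<theta>. \<integral>t. surv \<theta> n t \<partial>lborel) has_integral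
      measure_pmf.expectation (grid_sets L X n) (\<lambda>S. Fav (grid_union L n S))) {0..pi}"
proof -
  let ?G = "grid_sets L X n"
  have "((\<lambda>\<theta>. \<Sum>S\<in>set_pmf ?G. pmf ?G S * (\<integral>t. shadow n S \<theta> t \<partial>lborel)) has_integral
      (\<Sum>S\<in>set_pmf ?G. pmf ?G S * Fav (grid_union L n S))) {0..pi}"
    using finite_set_grid_sets Fav_has_integral by (intro has_integral_sum has_integral_mult_right) auto
  also have "(\<Sum>S\<in>set_pmf ?G. pmf ?G S * Fav (grid_union L n S)) = measure_pmf.expectation ?G (\<lambda>S. Fav (grid_union L n S))"
    by (subst integral_measure_pmf_real[OF finite_set_grid_sets]) (auto simp: mult_ac)
  finally show ?thesis
  proof (rule has_integral_eq[rotated])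
    fix \<theta> assume th: "\<theta> \<in> {0..pi}"
    have "(\<integral>t. surv \<theta> n t \<partial>lborel) = (\<integral>t. (\<Sum>S\<in>set_pmf ?G. pmf ?G S * shadow n S \<theta> t) \<partial>lborel)"
      unfolding expectation_shadow ..
    also have "\<dots> = (\<Sum>S\<in>set_pmf ?G. pmf ?G S * (\<integral>t. shadow n S \<theta> t \<partial>lborel))"
      using shadow_integrable[OF th finite_grid_sets] by (subst Bochner_Integration.integral_sum) auto
    finally show "(\<Sum>S\<in>set_pmf ?G. pmf ?G S * (\<integral>t. shadow n S \<theta> t \<partial>lborel)) = (\<integral>t. surv \<theta> n t \<partial>lborel)" ..
  qed
qed

end

subsection \<open>Choosing the pair of squares\<close>

context uniform_grid
begin

lemma pair_prob_pos: "S \<in> set_pmf X \<Longrightarrow> A \<in> S \<Longrightarrow> B \<in> S \<Longrightarrow> 0 < pair_prob A B"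
  unfolding pair_prob_def by (rule measure_pmf_posI[of S]) auto

text \<open>By uniformity the expected number of selected squares in \<open>E\<close> is 1; a
  variable bounded by its mean equals it almost surely, hence on the whole support.\<close>

lemma card_inter_eq_one:
  assumes E: "E \<subseteq> cells" "card E = L"
    and le: "\<And>S. S \<in> set_pmf X \<Longrightarrow> card (S \<inter> E) \<le> 1"
    and S: "S \<in> set_pmf X"
  shows "card (S \<inter> E) = 1"
proof -
  have "measure_pmf.expectation X (\<lambda>S. real (card (S \<inter> E))) = measure_pmf.expectation X (\<lambda>S. \<Sum>D\<in>S. indicator E D)"
    by (intro integral_cong_AE) (auto simp: AE_measure_pmf_iff finite_sample indicator_def sum.If_cases Int_def)
  also have "\<dots> = real (card (cells \<inter> E)) / L"
    unfolding expectation_sum by (simp add: indicator_def sum.If_cases Int_def)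
  also have "cells \<inter> E = E" using E by blast
  finally have "measure_pmf.expectation X (\<lambda>S. 1 - real (card (S \<inter> E))) = 0"
    using E L2 by simp
  then have "AE S in X. 1 - real (card (S \<inter> E)) = 0"
    using le by (subst (asm) integral_nonneg_eq_0_iff_AE) (auto simp: AE_measure_pmf_iff)
  then show ?thesis using S by (auto simp: AE_measure_pmf_iff)
qed

lemma exists_column_pair:
  assumes "\<not> vert_degenerate L X"
  obtains S i j k where "S \<in> set_pmf X" "(i, j) \<in> S" "(i, k) \<in> S" "j \<noteq> k"
proof -
  have "\<exists>S\<in>set_pmf X. \<exists>i j k. (i, j) \<in> S \<and> (i, k) \<in> S \<and> j \<noteq> k"
  proof (rule ccontr)
    assume no: "\<not> ?thesis"
    have "card {j. (i, j) \<in> S} = 1" if S: "S \<in> set_pmf X" and i: "i < L" for S i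
    proof -
      have "card (S \<inter> {i} \<times> {..<L}) = 1"
      proof (rule card_inter_eq_one[OF _ _ _ S])
        fix S assume S: "S \<in> set_pmf X"
        show "card (S \<inter> {i} \<times> {..<L}) \<le> 1"
          using no S finite_sample[OF S] by (auto simp: card_le_Suc0_iff_eq)
      qed (use i in \<open>auto simp: card_cartesian_product\<close>)
      also have "S \<inter> {i} \<times> {..<L} = Pair i ` {j. (i, j) \<in> S}" using supp[OF S] by auto
      finally show ?thesis by (simp add: card_image inj_on_def)
    qed
    then have "vert_degenerate L X" by (simp add: vert_degenerate_def AE_measure_pmf_iff)
    with assms show False by contradiction
  qed
  then show ?thesis using that by blast
qed

lemma exists_row_pair:
  assumes "\<not> horiz_degenerate L X"
  obtains S i j k where "S \<in> set_pmf X" "(i, k) \<in> S" "(j, k) \<in> S" "i \<noteq> j"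
proof -
  have "\<exists>S\<in>set_pmf X. \<exists>i j k. (i, k) \<in> S \<and> (j, k) \<in> S \<and> i \<noteq> j"
  proof (rule ccontr)
    assume no: "\<not> ?thesis"
    have "card {i. (i, k) \<in> S} = 1" if S: "S \<in> set_pmf X" and k: "k < L" for S k
    proof -
      have "card (S \<inter> {..<L} \<times> {k}) = 1"
      proof (rule card_inter_eq_one[OF _ _ _ S])
        fix S assume S: "S \<in> set_pmf X"
        show "card (S \<inter> {..<L} \<times> {k}) \<le> 1"
          using no S finite_sample[OF S] by (auto simp: card_le_Suc0_iff_eq)
      qed (use k in \<open>auto simp: card_cartesian_product\<close>)
      also have "S \<inter> {..<L} \<times> {k} = (\<lambda>i. (i, k)) ` {i. (i, k) \<in> S}" using supp[OF S] by auto
      finally show ?thesis by (simp add: card_image inj_on_def)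
    qed
    then have "horiz_degenerate L X" by (simp add: horiz_degenerate_def AE_measure_pmf_iff)
    with assms show False by contradiction
  qed
  then show ?thesis using that by blast
qed

text \<open>The least offset belongs to one corner cell. Any other cell is at least one step away in
  some coordinate, which raises the offset by \<open>sin \<theta>\<close> or
  \<open>\<bar>cos \<theta>\<bar>\<close>.\<close>

lemma offset_corner_gap:
  assumes s: "0 \<le> sin \<theta>" and D: "D \<in> cells" "D \<noteq> (L - 1, if cos \<theta> \<ge> 0 then 0 else L - 1)"
  shows "(real L - 1) * lo \<theta> + min (sin \<theta>) \<bar>cos \<theta>\<bar> \<le> offset \<theta> D"
proof -
  obtain a b where ab: "D = (a, b)" "a < L" "b < L" using D by auto
  define p where "p = real L - 1 - real a"
  define q where "q = (if cos \<theta> \<ge> 0 then real b else real L - 1 - real b)"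
  have eq: "offset \<theta> D - (real L - 1) * lo \<theta> = p * sin \<theta> + q * \<bar>cos \<theta>\<bar>"
    by (auto simp: offset_def lo_def ab p_def q_def algebra_simps)
  have "p \<ge> 0" "q \<ge> 0" using ab by (auto simp: p_def q_def)
  have "p \<ge> 1 \<or> q \<ge> 1" using D(2) ab by (auto simp: p_def q_def split: if_splits)
  then have "min (sin \<theta>) \<bar>cos \<theta>\<bar> \<le> p * sin \<theta> + q * \<bar>cos \<theta>\<bar>"
  proof
    assume "p \<ge> 1"
    then have "1 * sin \<theta> \<le> p * sin \<theta>" using s by (intro mult_right_mono)
    moreover have "0 \<le> q * \<bar>cos \<theta>\<bar>" using \<open>q \<ge> 0\<close> by simp
    ultimately show ?thesis by linarith
  next
    assume "q \<ge> 1"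
    then have "1 * \<bar>cos \<theta>\<bar> \<le> q * \<bar>cos \<theta>\<bar>" by (intro mult_right_mono) auto
    moreover have "0 \<le> p * sin \<theta>" using \<open>p \<ge> 0\<close> s by simp
    ultimately show ?thesis by linarith
  qed
  with eq show ?thesis by linarith
qed

text \<open>If no line met the interiors of two simultaneously selected squares, \<open>avg\<close> would map the
  indicator of the open shadow below itself. As \<open>avg\<close> preserves integrals, equality would hold almost everywhere,
  which fails for lines cutting a corner of the unit square: they meet a single square.\<close>

lemma exists_pair_oblique:
  assumes th: "\<theta> \<in> {0..pi}" and sc: "sin \<theta> \<noteq> 0" "cos \<theta> \<noteq> 0"
  shows "\<exists>S\<in>set_pmf X. \<exists>A\<in>S. \<exists>B\<in>S. A \<noteq> B \<and>
    (\<exists>t. zoom \<theta> A t \<in> {lo \<theta><..<hi \<theta>} \<and> zoom \<theta> B t \<in> {lo \<theta><..<hi \<theta>})"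
proof (rule ccontr)
  assume no: "\<not> ?thesis"
  define I :: "real \<Rightarrow> real" where "I = indicator {lo \<theta><..<hi \<theta>}"
  define e where "e = min (sin \<theta>) \<bar>cos \<theta>\<bar>"
  \<comment> \<open>The strip of lines cutting off the corner: \<open>zoom\<close> multiplies by
    \<open>L\<close>, so width \<open>e / L\<close> stays within the gap \<open>e\<close> between
    the corner cell and all others.\<close>
  define J :: "real \<Rightarrow> real" where "J = indicator {lo \<theta><..<lo \<theta> + e / L}"
  have s: "0 < sin \<theta>" using th sc sin_ge_zero[of \<theta>] by auto
  have e: "e > 0" using s sc by (simp add: e_def)
  have L: "real L \<ge> 2" using L2 by simp
  have eL: "e / L \<le> hi \<theta> - lo \<theta>"
  proof -
    have "e / L \<le> e" using L e by (simp add: divide_le_eq)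
    also have "\<dots> \<le> hi \<theta> - lo \<theta>" using s by (auto simp: e_def lo_def hi_def)
    finally show ?thesis .
  qed
  have lh: "lo \<theta> \<le> hi \<theta>" by (rule lo_hi_bounds[OF th])
  have I_int: "integrable lborel I" unfolding I_def
    by (intro integrable_real_indicator) (use lh in auto)
  have J_int: "integrable lborel J" unfolding J_def
    by (intro integrable_real_indicator) (use e in auto)
  \<comment> \<open>On the strip one cell contributes at most \<open>1 / L \<le> 1 / 2\<close>;
    elsewhere the assumption \<open>no\<close> lets each sample contribute at most 1.\<close>
  have avg_le: "avg \<theta> I t \<le> hit \<theta> t - J t / 2" for t
  proof (cases "t \<in> {lo \<theta>..hi \<theta>}")
    case False
    have "I (zoom \<theta> D t) = 0" if "D \<in> cells" for D
    proof -
      have "zoom \<theta> D t \<notin> {lo \<theta>..hi \<theta>}" using hit_zoom[OF th that, of t] False by blast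
      then show ?thesis by (auto simp: I_def indicator_def)
    qed
    then have "avg \<theta> I t = 0" by (simp add: avg_def)
    moreover have "J t = 0" using False eL by (auto simp: J_def indicator_def)
    ultimately show ?thesis by (simp add: hit_bounds)
  next
    case t: True
    show ?thesis
    proof (cases "J t = 0")
      case True
      have "avg \<theta> I t = measure_pmf.expectation X (\<lambda>S. \<Sum>D\<in>S. I (zoom \<theta> D t))"
        by (simp add: expectation_sum avg_def)
      also have "\<dots> \<le> measure_pmf.expectation X (\<lambda>S. 1)"
      proof (rule expectation_mono)
        fix S assume S: "S \<in> set_pmf X"
        have fin: "finite S" by (rule finite_sample[OF S])
        let ?T = "{D \<in> S. zoom \<theta> D t \<in> {lo \<theta><..<hi \<theta>}}"
        have "\<forall>D\<in>?T. \<forall>D'\<in>?T. D = D'" using no S by blast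
        then have "card ?T \<le> 1" using fin by (simp add: card_le_Suc0_iff_eq)
        moreover have "(\<Sum>D\<in>S. I (zoom \<theta> D t)) = card ?T"
          unfolding I_def indicator_def of_bool_def using fin by (simp add: sum.If_cases Int_def)
        ultimately show "(\<Sum>D\<in>S. I (zoom \<theta> D t)) \<le> 1" by simp
      qed
      finally show ?thesis using True t by (simp add: hit_def)
    next
      case False
      then have J: "J t = 1" "t < lo \<theta> + e / L" by (auto simp: J_def indicator_def split: if_splits)
      then have Lt: "L * t < L * lo \<theta> + e" using L by (simp add: field_simps)
      define D0 where "D0 = (L - 1, if cos \<theta> \<ge> 0 then 0 else L - 1)"
      have D0: "D0 \<in> cells" using L2 by (auto simp: D0_def)
      have "I (zoom \<theta> D t) = 0" if "D \<in> cells - {D0}" for D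
      proof -
        have "(real L - 1) * lo \<theta> + e \<le> offset \<theta> D"
          unfolding e_def using that s by (intro offset_corner_gap) (auto simp: D0_def)
        then have "zoom \<theta> D t < lo \<theta>" using Lt by (simp add: zoom_def algebra_simps)
        then show ?thesis by (simp add: I_def)
      qed
      then have "(\<Sum>D\<in>cells. I (zoom \<theta> D t)) = I (zoom \<theta> D0 t)"
        using D0 by (subst sum.remove[of cells D0]) auto
      also have "\<dots> \<le> 1" by (simp add: I_def indicator_def)
      finally have "avg \<theta> I t \<le> 1 / L" unfolding avg_def by (intro divide_right_mono) auto
      also have "\<dots> \<le> 1 / 2" using L by (intro divide_left_mono) auto
      finally show ?thesis using t J by (simp add: hit_def)
    qed
  qed
  have "hi \<theta> - lo \<theta> = (\<integral>t. I t \<partial>lborel)" unfolding I_def using lh by simp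
  also have "\<dots> = (\<integral>t. avg \<theta> I t \<partial>lborel)" using integral_avg[OF I_int] by simp
  also have "\<dots> \<le> (\<integral>t. hit \<theta> t - J t / 2 \<partial>lborel)"
    using integral_avg[OF I_int] J_int avg_le by (intro integral_mono) auto
  also have "\<dots> = (hi \<theta> - lo \<theta>) - (e / L) / 2"
    using J_int e L by (simp add: hit_integral[OF th]) (simp add: J_def)
  finally show False using e L by (simp add: divide_le_0_iff)
qed

text \<open>In an axis direction non-degeneracy yields two squares in one column or row; their
  offsets agree, so one line passes through the middle of both shadows. The open interval for
  \<open>B\<close> is what \<open>chord_locally_bounded_below\<close> asks for; the closed one for
  \<open>A\<close> is enough to choose digits below it.\<close>

lemma exists_pair:
  assumes nd: "non_degenerate L X" and th: "\<theta> \<in> {0..pi}"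
  obtains A B t where "A \<in> cells" "B \<in> cells" "A \<noteq> B" "pair_prob A B > 0"
    "zoom \<theta> A t \<in> {lo \<theta>..hi \<theta>}" "zoom \<theta> B t \<in> {lo \<theta><..<hi \<theta>}"
proof -
  have "\<exists>S\<in>set_pmf X. \<exists>A\<in>S. \<exists>B\<in>S. A \<noteq> B \<and>
    (\<exists>t. zoom \<theta> A t \<in> {lo \<theta><..<hi \<theta>} \<and> zoom \<theta> B t \<in> {lo \<theta><..<hi \<theta>})"
  proof (cases "sin \<theta> \<noteq> 0 \<and> cos \<theta> \<noteq> 0")
    case True
    then show ?thesis using exists_pair_oblique[OF th] by blast
  next
    case False
    have "\<exists>S\<in>set_pmf X. \<exists>A\<in>S. \<exists>B\<in>S. A \<noteq> B \<and> offset \<theta> A = offset \<theta> B"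
    proof (cases "cos \<theta> = 0")
      case True
      obtain S i j k where "S \<in> set_pmf X" "(i, j) \<in> S" "(i, k) \<in> S" "j \<noteq> k"
        using nd exists_column_pair unfolding non_degenerate_def by metis
      then show ?thesis using True by (intro bexI[of _ S] bexI[of _ "(i, j)"] bexI[of _ "(i, k)"]) (auto simp: offset_def)
    next
      case 2: False
      obtain S i j k where "S \<in> set_pmf X" "(i, k) \<in> S" "(j, k) \<in> S" "i \<noteq> j"
        using nd exists_row_pair unfolding non_degenerate_def by metis
      then show ?thesis using False 2 by (intro bexI[of _ S] bexI[of _ "(i, k)"] bexI[of _ "(j, k)"]) (auto simp: offset_def)
    qed
    then obtain S A B where S: "S \<in> set_pmf X" "A \<in> S" "B \<in> S" "A \<noteq> B" "offset \<theta> A = offset \<theta> B" by blast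
    define t where "t = ((lo \<theta> + hi \<theta>) / 2 + offset \<theta> A) / L"
    have "zoom \<theta> A t = (lo \<theta> + hi \<theta>) / 2" "zoom \<theta> B t = (lo \<theta> + hi \<theta>) / 2"
      using S(5) L2 by (auto simp: zoom_def t_def)
    moreover have "lo \<theta> < hi \<theta>" by (rule unit_square_parametrisation[OF th])
    ultimately have "zoom \<theta> A t \<in> {lo \<theta><..<hi \<theta>}" "zoom \<theta> B t \<in> {lo \<theta><..<hi \<theta>}" by auto
    then show ?thesis using S by blast
  qed
  then obtain S A B t where S: "S \<in> set_pmf X" "A \<in> S" "B \<in> S" "A \<noteq> B"
    and t: "zoom \<theta> A t \<in> {lo \<theta><..<hi \<theta>}" "zoom \<theta> B t \<in> {lo \<theta><..<hi \<theta>}" by blast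
  show ?thesis
    by (rule that[of A B t]) (use S t supp pair_prob_pos in \<open>auto simp: greaterThanLessThan_iff\<close>)
qed

lemma exists_zoom:
  assumes th: "\<theta> \<in> {0..pi}" and t: "t \<in> {lo \<theta>..hi \<theta>}"
  shows "\<exists>D\<in>cells. zoom \<theta> D t \<in> {lo \<theta>..hi \<theta>}"
proof -
  obtain x y where xy: "x \<in> {0..1}" "y \<in> {0..1}" and t: "t = y * cos \<theta> - x * sin \<theta>"
    using t unfolding shadow_unit_square[OF th] by blast
  have digit: "\<exists>a<L. real L * x - real a \<in> {0..1}" if "x \<in> {0..1}" for x
  \<comment> \<open>At the right end the integer part of \<open>L * x\<close> would be
    \<open>L\<close>, so the last closed cell is taken instead.\<close>
  proof (cases "x = 1")
    case True
    then show ?thesis using L2 by (intro exI[of _ "L - 1"]) (auto simp: of_nat_diff)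
  next
    case False
    then have nn: "0 \<le> real L * x" "real L * x < real L" using that L2 by auto
    then have k: "real (nat \<lfloor>real L * x\<rfloor>) \<le> real L * x" "real L * x \<le> real (nat \<lfloor>real L * x\<rfloor>) + 1" by linarith+
    then have "nat \<lfloor>real L * x\<rfloor> < L" using nn by linarith
    then show ?thesis using k
      by (intro exI[of _ "nat \<lfloor>real L * x\<rfloor>"] conjI) (assumption, unfold atLeastAtMost_iff, linarith)
  qed
  obtain a b where a: "a < L" "real L * x - real a \<in> {0..1}" and b: "b < L" "real L * y - real b \<in> {0..1}"
    using digit xy by blast
  have "zoom \<theta> (a, b) t = (real L * y - real b) * cos \<theta> - (real L * x - real a) * sin \<theta>"
    by (simp add: zoom_def offset_def t algebra_simps)
  then have "zoom \<theta> (a, b) t \<in> {lo \<theta>..hi \<theta>}"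
    unfolding shadow_unit_square[OF th] using a b by blast
  then show ?thesis using a b by blast
qed

lemma exists_zooms:
  assumes "\<theta> \<in> {0..pi}" "t \<in> {lo \<theta>..hi \<theta>}"
  shows "\<exists>ds. set ds \<subseteq> cells \<and> length ds = k \<and> zooms \<theta> ds t \<in> {lo \<theta>..hi \<theta>}"
  using assms(2)
proof (induction k arbitrary: t)
  case 0
  then show ?case by simp
next
  case (Suc k)
  obtain D where D: "D \<in> cells" "zoom \<theta> D t \<in> {lo \<theta>..hi \<theta>}" using exists_zoom[OF assms(1) Suc.prems] by blast
  obtain ds where "set ds \<subseteq> cells" "length ds = k" "zooms \<theta> ds (zoom \<theta> D t) \<in> {lo \<theta>..hi \<theta>}"
    using Suc.IH[OF D(2)] by blast
  then show ?case using D by (intro exI[of _ "D # ds"]) auto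
qed

text \<open>Continuity of \<open>P\<close> lets a digit block chosen for one direction serve nearby
  directions as well.\<close>

lemma zooms_eq_affine:
  "\<exists>P. continuous_on UNIV P \<and> (\<forall>\<theta> t. zooms \<theta> ds t = real L ^ length ds * t - P \<theta>)"
proof (induction ds)
  case Nil
  then show ?case by (intro exI[of _ "\<lambda>_. 0"]) auto
next
  case (Cons d ds)
  then obtain P where P: "continuous_on UNIV P" "\<And>\<theta> t. zooms \<theta> ds t = real L ^ length ds * t - P \<theta>" by blast
  show ?case
    by (intro exI[of _ "\<lambda>\<theta>. real L ^ length ds * offset \<theta> d + P \<theta>"] conjI)
       (auto simp: P zoom_def offset_def algebra_simps intro!: continuous_intros)
qed

end

section \<open>Bounds uniform in the direction\<close>

lemma chord_ge:
  assumes th: "\<theta> \<in> {0..pi}" and ab: "a \<le> b"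
    and sub: "\<And>u. u \<in> {a..b} \<Longrightarrow> u * cos \<theta> - t * sin \<theta> \<in> {0..<1} \<and> t * cos \<theta> + u * sin \<theta> \<in> {0..<1}"
  shows "b - a \<le> chord \<theta> t"
proof -
  define E where "E = {u. u * cos \<theta> - t * sin \<theta> \<in> {0..<1} \<and> t * cos \<theta> + u * sin \<theta> \<in> {0..<1}}"
  have "E \<in> fmeasurable lborel"
  proof (rule fmeasurableI2)
    show "{-1..2::real} \<in> fmeasurable lborel" by (simp add: fmeasurable_def)
    show "E \<subseteq> {-1..2}" using chord_set_subset(1)[OF th] unfolding E_def by blast
    show "E \<in> sets lborel" unfolding E_def using chord_set_measurable by simp
  qed
  then have "measure lborel {a..b} \<le> measure lborel E"
    by (rule measure_mono_fmeasurable[rotated 2]) (use sub in \<open>auto simp: E_def\<close>)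
  then show ?thesis using ab by (simp add: chord_def E_def)
qed

text \<open>The line carries a point of the open unit square. Membership is an open condition on
  direction, parameter and position jointly, so a whole segment stays inside for all nearby
  lines.\<close>

lemma chord_locally_bounded_below:
  assumes th: "\<theta>0 \<in> {0..pi}" and t0: "t0 \<in> {lo \<theta>0<..<hi \<theta>0}"
  obtains r where "r > 0" "\<And>\<theta> t. \<theta> \<in> {0..pi} \<Longrightarrow> \<bar>\<theta> - \<theta>0\<bar> < r \<Longrightarrow> \<bar>t - t0\<bar> < r \<Longrightarrow> r \<le> chord \<theta> t"
proof -
  define l where "l = (t0 - lo \<theta>0) / (hi \<theta>0 - lo \<theta>0)"
  have lh: "lo \<theta>0 < hi \<theta>0" by (rule unit_square_parametrisation[OF th])
  have l: "l \<in> {0<..<1}" using t0 lh by (auto simp: l_def)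
  define x where "x = 1 - l"
  define y where "y = (if cos \<theta>0 \<ge> 0 then l else 1 - l)"
  have xy: "x \<in> {0<..<1}" "y \<in> {0<..<1}" using l by (auto simp: x_def y_def)
  have t0_eq: "t0 = y * cos \<theta>0 - x * sin \<theta>0"
    using unit_square_parametrisation(2)[OF th, of l] lh by (simp add: x_def y_def l_def)
  define u0 where "u0 = x * cos \<theta>0 + y * sin \<theta>0"
  have sq: "(sin \<theta>0)\<^sup>2 + (cos \<theta>0)\<^sup>2 = 1" by simp
  have x_eq: "u0 * cos \<theta>0 - t0 * sin \<theta>0 = x" and y_eq: "t0 * cos \<theta>0 + u0 * sin \<theta>0 = y"
    unfolding u0_def t0_eq using sq by algebra+
  define W where "W = (\<lambda>(\<theta>, t, u). (u * cos \<theta> - t * sin \<theta>, t * cos \<theta> + u * sin \<theta>)) -` ({0<..<1} \<times> {0<..<1::real})"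
  have "open W" unfolding W_def case_prod_beta
    by (intro open_vimage open_Times open_greaterThanLessThan continuous_intros)
  moreover have "(\<theta>0, t0, u0) \<in> W" using xy by (simp add: W_def x_eq y_eq)
  ultimately obtain e where e: "e > 0" "ball (\<theta>0, t0, u0) e \<subseteq> W" by (auto simp: open_contains_ball)
  \<comment> \<open>Three coordinate deviations of at most \<open>e / 4\<close> keep the distance
    below \<open>e\<close>.\<close>
  define r where "r = e / 4"
  have r: "r > 0" using e by (simp add: r_def)
  have W: "(\<theta>, t, u) \<in> W" if "\<bar>\<theta> - \<theta>0\<bar> < r" "\<bar>t - t0\<bar> < r" "\<bar>u - u0\<bar> \<le> r" for \<theta> t u
  proof -
    have "dist (\<theta>0, t0, u0) (\<theta>, t, u) \<le> dist \<theta>0 \<theta> + dist (t0, u0) (t, u)"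
      unfolding dist_Pair_Pair by (rule sqrt_sum_squares_le_sum) auto
    also have "dist (t0, u0) (t, u) \<le> dist t0 t + dist u0 u"
      unfolding dist_Pair_Pair by (rule sqrt_sum_squares_le_sum) auto
    also have "dist \<theta>0 \<theta> + (dist t0 t + dist u0 u) < e"
      using that e(1) unfolding dist_real_def r_def by linarith
    finally show ?thesis using e by (auto simp: mem_ball)
  qed
  have "r \<le> chord \<theta> t" if "\<theta> \<in> {0..pi}" "\<bar>\<theta> - \<theta>0\<bar> < r" "\<bar>t - t0\<bar> < r" for \<theta> t
  proof -
    have "u0 + r - u0 \<le> chord \<theta> t"
    proof (rule chord_ge[OF that(1)])
      fix u assume "u \<in> {u0..u0 + r}"
      then have "(\<theta>, t, u) \<in> W" using r by (intro W that) auto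
      then show "u * cos \<theta> - t * sin \<theta> \<in> {0..<1} \<and> t * cos \<theta> + u * sin \<theta> \<in> {0..<1}"
        by (auto simp: W_def)
    qed (use r in simp)
    then show ?thesis by simp
  qed
  then show ?thesis using that r by blast
qed

context uniform_grid
begin

text \<open>The pair and the digit block are fixed at \<open>\<theta>0\<close>. A block long enough
  makes the shadow of the descendant of \<open>A\<close> so short that all lines through it, in all
  nearby directions, meet \<open>B\<close> close to the reference line.\<close>

lemma surv_integral_le_local:
  assumes nd: "non_degenerate L X" and th0: "\<theta>0 \<in> {0..pi}"
  obtains d C where "d > 0"
    "\<And>\<theta> n. \<theta> \<in> {0..pi} \<Longrightarrow> \<bar>\<theta> - \<theta>0\<bar> < d \<Longrightarrow> n \<ge> 1 \<Longrightarrow> (\<integral>t. surv \<theta> n t \<partial>lborel) \<le> C / real n"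
proof -
  obtain A B t0 where AB: "A \<in> cells" "B \<in> cells" "A \<noteq> B" and p: "pair_prob A B > 0"
    and tA: "zoom \<theta>0 A t0 \<in> {lo \<theta>0..hi \<theta>0}" and tB: "zoom \<theta>0 B t0 \<in> {lo \<theta>0<..<hi \<theta>0}"
    using exists_pair[OF nd th0] by blast
  obtain r where r: "r > 0"
    "\<And>\<theta> t. \<theta> \<in> {0..pi} \<Longrightarrow> \<bar>\<theta> - \<theta>0\<bar> < r \<Longrightarrow> \<bar>t - zoom \<theta>0 B t0\<bar> < r \<Longrightarrow> r \<le> chord \<theta> t"
    using chord_locally_bounded_below[OF th0 tB] by blast
  have L: "real L > 1" using L2 by simp
  \<comment> \<open>After scaling by \<open>L ^ Suc k\<close> the parameters of interest differ by
    at most 5 (2 for each shadow, 1 for the drift of \<open>P\<close>); this \<open>k\<close> turns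
    that into less than \<open>r / 2\<close> at the scale of \<open>B\<close>. The other
    \<open>r / 2\<close> is left for the drift of \<open>offset\<close>.\<close>
  obtain k where k: "10 / r < real L ^ k" using real_arch_pow[OF L] by blast
  obtain ds where ds: "set ds \<subseteq> cells" "length ds = k" "zooms \<theta>0 ds (zoom \<theta>0 A t0) \<in> {lo \<theta>0..hi \<theta>0}"
    using exists_zooms[OF th0 tA] by blast
  obtain P where P: "continuous_on UNIV P" "\<And>\<theta> t. zooms \<theta> (A # ds) t = real L ^ Suc k * t - P \<theta>"
    using zooms_eq_affine[of "A # ds"] ds(2) by auto
  have "continuous (at \<theta>0) P" using P(1) by (simp add: continuous_on_eq_continuous_at)
  then obtain d1 where d1: "d1 > 0" "\<And>\<theta>. \<bar>\<theta> - \<theta>0\<bar> < d1 \<Longrightarrow> \<bar>P \<theta> - P \<theta>0\<bar> < 1"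
    unfolding continuous_at_eps_delta dist_real_def by (metis zero_less_one)
  have "continuous (at \<theta>0) (\<lambda>\<theta>. offset \<theta> B)" unfolding offset_def by (intro continuous_intros)
  then obtain d2 where d2: "d2 > 0" "\<And>\<theta>. \<bar>\<theta> - \<theta>0\<bar> < d2 \<Longrightarrow> \<bar>offset \<theta> B - offset \<theta>0 B\<bar> < r / 2"
    unfolding continuous_at_eps_delta dist_real_def using r(1) by (metis half_gt_zero)
  define d where "d = min r (min d1 d2)"
  have d: "d > 0" using r d1 d2 by (simp add: d_def)
  have lohi: "- 2 \<le> lo \<theta> \<and> hi \<theta> \<le> 2" for \<theta>
    using sin_le_one[of \<theta>] cos_le_one[of \<theta>] cos_ge_minus_one[of \<theta>] unfolding lo_def hi_def by linarith
  have good: "r \<le> chord \<theta> (zoom \<theta> B t)"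
    if th: "\<theta> \<in> {0..pi}" and near: "\<bar>\<theta> - \<theta>0\<bar> < d" and z: "zooms \<theta> ds (zoom \<theta> A t) \<in> {lo \<theta>..hi \<theta>}" for \<theta> t
  proof (rule r(2)[OF th])
    show "\<bar>\<theta> - \<theta>0\<bar> < r" using near by (simp add: d_def)
    have "\<bar>P \<theta> - P \<theta>0\<bar> < 1" using near by (intro d1) (simp add: d_def)
    moreover have "\<bar>real L ^ Suc k * t - P \<theta>\<bar> \<le> 2"
      using z lohi[of \<theta>] P(2)[of \<theta> t] by auto
    moreover have "\<bar>real L ^ Suc k * t0 - P \<theta>0\<bar> \<le> 2"
      using ds(3) lohi[of \<theta>0] P(2)[of \<theta>0 t0] by auto
    ultimately have "\<bar>real L ^ Suc k * t - real L ^ Suc k * t0\<bar> \<le> 5" by linarith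
    also have "real L ^ Suc k * t - real L ^ Suc k * t0 = real L ^ k * (real L * t - real L * t0)"
      by (simp add: algebra_simps)
    finally have *: "real L ^ k * \<bar>real L * t - real L * t0\<bar> \<le> 5"
      by (simp add: abs_mult)
    have "\<bar>real L * t - real L * t0\<bar> < r / 2"
    proof (rule ccontr)
      assume "\<not> ?thesis"
      then have "10 / r * (r / 2) < real L ^ k * \<bar>real L * t - real L * t0\<bar>"
        using k r(1) by (intro mult_less_le_imp_less) auto
      with * show False using r(1) by simp
    qed
    moreover have "\<bar>offset \<theta> B - offset \<theta>0 B\<bar> < r / 2" using near by (intro d2) (simp add: d_def)
    ultimately show "\<bar>zoom \<theta> B t - zoom \<theta>0 B t0\<bar> < r" unfolding zoom_def by linarith
  qed
  show ?thesis
    by (rule that[OF d]) (rule surv_integral_le[OF _ AB ds(1) p r(1) good refl])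
qed

lemma surv_integral_le_uniform:
  assumes nd: "non_degenerate L X"
  obtains C where "C > 0"
    "\<And>\<theta> n. \<theta> \<in> {0..pi} \<Longrightarrow> n \<ge> 1 \<Longrightarrow> (\<integral>t. surv \<theta> n t \<partial>lborel) \<le> C / real n"
proof -
  have "\<forall>\<theta>0\<in>{0..pi}. \<exists>d C. d > 0 \<and> (\<forall>\<theta> n. \<theta> \<in> {0..pi} \<longrightarrow> \<bar>\<theta> - \<theta>0\<bar> < d \<longrightarrow> n \<ge> 1 \<longrightarrow> (\<integral>t. surv \<theta> n t \<partial>lborel) \<le> C / real n)"
    using surv_integral_le_local[OF nd] by metis
  then obtain d C where dC: "\<And>\<theta>0. \<theta>0 \<in> {0..pi} \<Longrightarrow> d \<theta>0 > 0"
    "\<And>\<theta>0 \<theta> n. \<theta>0 \<in> {0..pi} \<Longrightarrow> \<theta> \<in> {0..pi} \<Longrightarrow> \<bar>\<theta> - \<theta>0\<bar> < d \<theta>0 \<Longrightarrow> n \<ge> 1 \<Longrightarrow> (\<integral>t. surv \<theta> n t \<partial>lborel) \<le> C \<theta>0 / real n"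
    by metis
  obtain T where T: "T \<subseteq> {0..pi}" "finite T" "{0..pi} \<subseteq> (\<Union>\<theta>0\<in>T. ball \<theta>0 (d \<theta>0))"
    by (rule compactE_image[of "{0..pi}" "{0..pi}" "\<lambda>\<theta>0. ball \<theta>0 (d \<theta>0)"]) (use dC(1) in auto)
  \<comment> \<open>The local constants carry no sign information: absolute values make the sum
    dominate each of them, and the 1 makes \<open>M\<close> positive.\<close>
  define M where "M = 1 + (\<Sum>\<theta>0\<in>T. \<bar>C \<theta>0\<bar>)"
  show ?thesis
  proof (rule that[of M])
    have "0 \<le> (\<Sum>\<theta>0\<in>T. \<bar>C \<theta>0\<bar>)" by (intro sum_nonneg) auto
    then show "M > 0" unfolding M_def by linarith
  next
    fix \<theta> and n :: nat assume th: "\<theta> \<in> {0..pi}" and n: "n \<ge> 1"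
    then obtain \<theta>0 where t0: "\<theta>0 \<in> T" "\<bar>\<theta> - \<theta>0\<bar> < d \<theta>0" using T(3) by (force simp: dist_real_def)
    then have "(\<integral>t. surv \<theta> n t \<partial>lborel) \<le> C \<theta>0 / real n" using T(1) th n by (intro dC) auto
    also have "\<dots> \<le> M / real n"
      using member_le_sum[of \<theta>0 T "\<lambda>\<theta>0. \<bar>C \<theta>0\<bar>"] t0 T(2) by (intro divide_right_mono) (auto simp: M_def)
    finally show "(\<integral>t. surv \<theta> n t \<partial>lborel) \<le> M / real n" .
  qed
qed

text \<open>For nearly horizontal lines through the middle of the square the chord is at least
  \<open>1/2\<close>, so the pointwise bound \<open>surv_ge_chord\<close> can be integrated. A short
  interval of directions suffices for the order of the lower bound.\<close>

lemma surv_integral_ge: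
  assumes th: "\<theta> \<in> {0..1/10}" and n: "n \<ge> 1"
  shows "1 / (120 * (real L)\<^sup>2 * n) \<le> (\<integral>t. surv \<theta> n t \<partial>lborel)"
proof -
  have pi: "\<theta> \<in> {0..pi}" using th pi_gt3 by auto
  have s: "0 \<le> sin \<theta>" "sin \<theta> \<le> 1/10"
    using pi th sin_x_le_x[of \<theta>] by (auto intro: sin_ge_zero)
  have c: "9/10 \<le> cos \<theta>"
  proof (rule ccontr)
    assume "\<not> ?thesis"
    moreover have "0 \<le> cos \<theta>" using th pi_gt3 by (intro cos_ge_zero) auto
    ultimately have "(cos \<theta>)\<^sup>2 \<le> (9/10)\<^sup>2" by (intro power_mono) auto
    moreover have "(sin \<theta>)\<^sup>2 \<le> (1/10)\<^sup>2" using s by (intro power_mono) auto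
    moreover have "(sin \<theta>)\<^sup>2 + (cos \<theta>)\<^sup>2 = 1" by simp
    ultimately show False by (simp add: power2_eq_square)
  qed
  have chord: "1/2 \<le> chord \<theta> t" if t: "t \<in> {2/5..3/5}" for t
  proof -
    have "7/10 - 1/5 \<le> chord \<theta> t"
    proof (rule chord_ge[OF pi])
      fix u :: real assume u: "u \<in> {1/5..7/10}"
      have u0: "1/5 \<le> u" "u \<le> 7/10" "0 \<le> u" "2/5 \<le> t" "t \<le> 3/5" "0 \<le> t" using u t by auto
      have c1: "cos \<theta> \<le> 1" "0 \<le> cos \<theta>" using c by auto
      have "1/5 * (9/10) \<le> u * cos \<theta>" by (rule mult_mono) (use u0 c1 c in auto)
      moreover have "u * cos \<theta> \<le> 7/10 * 1" by (rule mult_mono) (use u0 c1 in auto)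
      moreover have "t * cos \<theta> \<le> 3/5 * 1" by (rule mult_mono) (use u0 c1 in auto)
      moreover have "t * sin \<theta> \<le> 3/5 * (1/10)" by (rule mult_mono) (use u0 s in auto)
      moreover have "u * sin \<theta> \<le> 7/10 * (1/10)" by (rule mult_mono) (use u0 s in auto)
      moreover have "0 \<le> t * sin \<theta>" "0 \<le> u * sin \<theta>" "0 \<le> t * cos \<theta>"
        using u0 s c1 by (auto intro: mult_nonneg_nonneg)
      ultimately show "u * cos \<theta> - t * sin \<theta> \<in> {0..<1} \<and> t * cos \<theta> + u * sin \<theta> \<in> {0..<1}" by auto
    qed simp
    then show ?thesis by simp
  qed
  \<comment> \<open>The 24 combines 6 from \<open>surv_ge_chord\<close>, the chord length
    \<open>1/2\<close>, and \<open>n + 1 \<le> 2 * n\<close>; the length \<open>1/5\<close> of the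
    parameter interval then yields 120.\<close>
  define c' where "c' = 1 / (24 * (real L)\<^sup>2 * n)"
  have L: "(real L)\<^sup>2 > 0" using L2 by simp
  have "c' * indicator {2/5..3/5} t \<le> surv \<theta> n t" for t :: real
  proof (cases "t \<in> {2/5..3/5}")
    case True
    have "c' = (1/2) / (6 * (real L)\<^sup>2 * (n + n))" by (simp add: c'_def)
    also have "\<dots> \<le> (1/2) / (6 * (real L)\<^sup>2 * (real n + 1))"
      using n L by (intro divide_left_mono mult_left_mono mult_pos_pos) auto
    also have "\<dots> \<le> chord \<theta> t / (6 * (real L)\<^sup>2 * (real n + 1))"
      using chord[OF True] by (intro divide_right_mono) auto
    also have "\<dots> \<le> surv \<theta> n t" by (rule surv_ge_chord[OF pi])
    finally show ?thesis using True by simp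
  qed (simp add: surv_bounds)
  then have "(\<integral>t. c' * indicator {2/5..3/5::real} t \<partial>lborel) \<le> (\<integral>t. surv \<theta> n t \<partial>lborel)"
    by (intro integral_mono surv_integrable[OF pi] integrable_mult_right integrable_real_indicator) auto
  then show ?thesis by (simp add: c'_def)
qed

end

section \<open>Integration over the directions\<close>

theorem theorem4p1:
  fixes L :: nat and X :: "(nat \<times> nat) set pmf"
  assumes "L \<ge> 2"
    and "grid_model L X"
    and "uniform_model L X"
    and "non_degenerate L X"
  shows "\<exists>c C. 0 < c \<and> c \<le> C \<and>
           (\<forall>n\<ge>1. c / real n \<le> measure_pmf.expectation (grid_sets L X n) (\<lambda>S. Fav (grid_union L n S))
                 \<and> measure_pmf.expectation (grid_sets L X n) (\<lambda>S. Fav (grid_union L n S)) \<le> C / real n)"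
proof -
  interpret uniform_grid L X
    by standard (use assms(1-3) in \<open>auto simp: grid_model_def uniform_model_def\<close>)
  define F where "F n = measure_pmf.expectation (grid_sets L X n) (\<lambda>S. Fav (grid_union L n S))" for n
  note F = expectation_Fav[folded F_def]
  obtain C where C: "C > 0"
    "\<And>\<theta> n. \<theta> \<in> {0..pi} \<Longrightarrow> n \<ge> 1 \<Longrightarrow> (\<integral>t. surv \<theta> n t \<partial>lborel) \<le> C / real n"
    using surv_integral_le_uniform[OF assms(4)] by blast
  \<comment> \<open>The constant of \<open>surv_integral_ge\<close> times the length
    \<open>1/10\<close> of the interval of directions.\<close>
  define c where "c = 1 / (1200 * (real L)\<^sup>2)"
  have c: "c > 0" using assms(1) by (simp add: c_def)
  have lower: "c / n \<le> F n" if n: "n \<ge> 1" for n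
  proof -
    let ?f = "\<lambda>\<theta>. \<integral>t. surv \<theta> n t \<partial>lborel"
    have sub: "{0..1/10} \<subseteq> {0..pi}" using pi_gt3 by auto
    have int: "?f integrable_on {0..1/10}"
      using has_integral_integrable[OF F[of n]] sub by (rule integrable_on_subinterval)
    have "c / n = integral {0..1/10::real} (\<lambda>_. 1 / (120 * (real L)\<^sup>2 * n))" by (simp add: c_def)
    also have "\<dots> \<le> integral {0..1/10} ?f"
      using int surv_integral_ge[OF _ n] by (intro integral_le) auto
    also have "\<dots> \<le> integral {0..pi} ?f"
      using sub int has_integral_integrable[OF F[of n]] surv_integral_bounds
      by (intro integral_subset_le) auto
    also have "\<dots> = F n" by (rule integral_unique[OF F])
    finally show ?thesis .
  qed
  have upper: "F n \<le> pi * C / n" if n: "n \<ge> 1" for n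
  proof -
    have "((\<lambda>_. C / n) has_integral pi * (C / n)) {0..pi}"
      using has_integral_const_real[of "C / n" 0 pi] by simp
    then have "F n \<le> pi * (C / n)"
      using C(2)[OF _ n] by (intro has_integral_le[OF F]) auto
    then show ?thesis by simp
  qed
  \<comment> \<open>Comparing both bounds at \<open>n = 1\<close> orders the two constants.\<close>
  have "c / real 1 \<le> pi * C / real 1" using lower[of 1] upper[of 1] by simp
  then have "c \<le> pi * C" by simp
  then show ?thesis using c lower upper unfolding F_def by blast
qed

end
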